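(* Let $\mathcal{P} \subset \mathbf{R}^2$ be an open (bounded) convex polygonal set containing the origin $0$, with cyclically ordered vertices $v_1, \ldots, v_n$, and let $f : \mathcal{P} \to \mathbf{R}^2$ be the map defined in the context. Let $d_{\mathcal{P}}$ be the Hilbert metric of $\mathcal{P}$ and let $d$ be the distance on $\mathbf{R}^2$ associated with the $\ell^1$-norm. Then: 1. $f$ is a homeomorphism from $\mathcal{P}$ onto $\mathbf{R}^2$. 2. If $\mathcal{U}$ and $\mathcal{V}$ are the open sets in $\mathbf{R}^2$ defined by $$\mathcal{U} := \mathcal{P} \setminus \Big( \bigcup_{k=1}^{n} [0,1) v_k \Big) \quad \text{and} \quad \mathcal{V} := \mathbf{R}^2 \setminus \Big( \bigcup_{k=1}^{n} \mathbf{R}_{+} v_k \Big),$$ then $f(\mathcal{U}) = \mathcal{V}$ and $f$ induces a smooth diffeomorphism from $\mathcal{U}$ onto $\mathcal{V}$. 3. There exists a constant $C \geq 1$ such that $$\frac{1}{C}\, d_{\mathcal{P}}(p,q) \leq d(f(p), f(q)) \leq C\, d_{\mathcal{P}}(p,q)$$ for all $p, q \in \mathcal{P}$.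
   Context: Hilbert metric: for an open bounded convex set $\mathcal{C} \subset \mathbf{R}^m$ and distinct points $p, q \in \mathcal{C}$, let $a, b$ be the intersection points of the straight line through $p$ and $q$ with $\partial \mathcal{C}$, labelled so that $p = (1-s)a + sb$ and $q = (1-t)a + tb$ with $0 < s < t < 1$. Then $d_{\mathcal{C}}(p,q) := \frac12 \ln\left( \frac{1-s}{s} \times \frac{t}{1-t} \right)$, and $d_{\mathcal{C}}(p,p) := 0$. The polygon: $\mathcal{P}$ is an open bounded convex polygonal set in $\mathbf{R}^2$ containing $0$; $v_1, \ldots, v_n$ ($n \geq 3$) are its vertices (the corner points of the convex set $\mathcal{P}$), assumed to be cyclically ordered in $\partial \mathcal{P}$; $v_0 := v_n$ and $v_{n+1} := v_1$. The map $f$: let $\mathcal{S} := (-1,1) \times (-1,1)$ and let $\Phi : \mathcal{S} \to \mathbf{R}^2$ be $\Phi(x,y) := (\operatorname{atanh}(x), \operatorname{atanh}(y))$. For each $k \in \{1, \ldots, n\}$ let $\Delta_k := \{ s v_k + t v_{k+1} \mid s \geq 0,\ t \geq 0,\ s + t < 1 \} \subset \mathcal{P}$, and let $L_k$ be the unique linear transformation of $\mathbf{R}^2$ with $L_k(v_k) = (1,-1)$ and $L_k(v_{k+1}) = (1,1)$. For $p \in \Delta_k$, set $f(p) := L_k^{-1}(\Phi(L_k(p)))$. This is well defined on $\mathcal{P}$: $\bigcup_{k=1}^n \Delta_k = \mathcal{P}$, $L_k(\Delta_k) \subset \mathcal{S}$, and the definitions agree on overlaps $\Delta_{k-1} \cap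 \Delta_k = [0,1) v_k$. Notation: $[0,1)v_k := \{ s v_k \mid 0 \leq s < 1 \}$ and $\mathbf{R}_{+} v_k := \{ s v_k \mid s \geq 0 \}$. The $\ell^1$-norm is $\|(X,Y)\| = |X| + |Y|$ and $d(P,Q) = \|P - Q\|$. *)

theory Defs
  imports "HOL-Analysis.Analysis"
begin

text \<open>
  The plane is \<^typ>\<open>real \<times> real\<close>.  Definite descriptions (THE) below stand for objects that
  are unique in the intended situation: the Hilbert distance of two distinct points of an open
  bounded convex set, the linear map prescribed on a basis, and the common value at \<open>p\<close> of the
  local formulas on the triangles containing \<open>p\<close>.
\<close>

definition hilbert_dist :: "'a::euclidean_space set \<Rightarrow> 'a \<Rightarrow> 'a \<Rightarrow> real" where
  "hilbert_dist C p q =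
     (if p = q then 0
      else (THE d. \<exists>a b s t.
              affine hull {p, q} \<inter> frontier C = {a, b} \<and>
              p = (1 - s) *\<^sub>R a + s *\<^sub>R b \<and>
              q = (1 - t) *\<^sub>R a + t *\<^sub>R b \<and>
              0 < s \<and> s < t \<and> t < 1 \<and>
              d = 1 / 2 * ln ((1 - s) / s * (t / (1 - t)))))"

definition l1_norm :: "real \<times> real \<Rightarrow> real" where
  "l1_norm P = \<bar>fst P\<bar> + \<bar>snd P\<bar>"

definition l1_dist :: "real \<times> real \<Rightarrow> real \<times> real \<Rightarrow> real" where
  "l1_dist P Q = l1_norm (P - Q)"

text \<open>
  The points \<open>v 1, \<dots>, v n\<close> of \<open>S\<close> are met in this order when a simple closed curve with image
  \<open>S\<close> is traversed once.  The curve may have either orientation.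
\<close>

definition cyclically_ordered_in ::
    "'a::topological_space set \<Rightarrow> nat \<Rightarrow> (nat \<Rightarrow> 'a) \<Rightarrow> bool" where
  "cyclically_ordered_in S n v \<longleftrightarrow>
     (\<exists>g \<tau>. simple_path g \<and> pathfinish g = pathstart g \<and> path_image g = S \<and>
            strict_mono_on {1..n} \<tau> \<and>
            (\<forall>k\<in>{1..n}. 0 \<le> \<tau> k \<and> \<tau> k < 1 \<and> g (\<tau> k) = v k))"

text \<open>
  An open bounded convex polygonal set together with an enumeration of its vertices, which is
  extended by \<open>v 0 = v n\<close> and \<open>v (n + 1) = v 1\<close>.  The enumeration is injective by the definition
  of cyclic order.
\<close>

definition open_convex_polygon ::
    "(real \<times> real) set \<Rightarrow> nat \<Rightarrow> (nat \<Rightarrow> real \<times> real) \<Rightarrow> bool" where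
  "open_convex_polygon P n v \<longleftrightarrow>
     open P \<and> bounded P \<and> convex P \<and> polytope (closure P) \<and>
     n \<ge> 3 \<and> v ` {1..n} = {x. x extreme_point_of closure P} \<and>
     cyclically_ordered_in (frontier P) n v \<and>
     v 0 = v n \<and> v (n + 1) = v 1"

definition Phi :: "real \<times> real \<Rightarrow> real \<times> real" where
  "Phi = (\<lambda>(x, y). (artanh x, artanh y))"

definition triangle :: "(nat \<Rightarrow> real \<times> real) \<Rightarrow> nat \<Rightarrow> (real \<times> real) set" where
  "triangle v k = {s *\<^sub>R v k + t *\<^sub>R v (k + 1) | s t. s \<ge> 0 \<and> t \<ge> 0 \<and> s + t < 1}"

definition L_map :: "(nat \<Rightarrow> real \<times> real) \<Rightarrow> nat \<Rightarrow> real \<times> real \<Rightarrow> real \<times> real" where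
  "L_map v k = (THE L. linear L \<and> L (v k) = (1, -1) \<and> L (v (k + 1)) = (1, 1))"

definition polygon_map ::
    "nat \<Rightarrow> (nat \<Rightarrow> real \<times> real) \<Rightarrow> real \<times> real \<Rightarrow> real \<times> real" where
  "polygon_map n v p =
     (THE q. \<exists>k\<in>{1..n}. p \<in> triangle v k \<and> q = inv (L_map v k) (Phi (L_map v k p)))"

text \<open>
  \<open>Ck_on k S f\<close>: the map \<open>f\<close> is of class \<open>C\<^sup>k\<close> on the open set \<open>S\<close>.  In the recursion, continuity
  of all the directional derivatives is continuity of the derivative, as the domain is finite
  dimensional.
\<close>

primrec Ck_on ::
    "nat \<Rightarrow> 'a::euclidean_space set \<Rightarrow> ('a \<Rightarrow> 'b::euclidean_space) \<Rightarrow> bool" where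
  "Ck_on 0 S f \<longleftrightarrow> continuous_on S f"
| "Ck_on (Suc k) S f \<longleftrightarrow>
     (\<forall>x\<in>S. f differentiable (at x)) \<and>
     (\<forall>h. Ck_on k S (\<lambda>x. frechet_derivative f (at x) h))"

definition smooth_on ::
    "'a::euclidean_space set \<Rightarrow> ('a \<Rightarrow> 'b::euclidean_space) \<Rightarrow> bool" where
  "smooth_on S f \<longleftrightarrow> (\<forall>k. Ck_on k S f)"

definition smooth_diffeomorphism ::
    "'a::euclidean_space set \<Rightarrow> 'b::euclidean_space set \<Rightarrow> ('a \<Rightarrow> 'b) \<Rightarrow> bool" where
  "smooth_diffeomorphism U V f \<longleftrightarrow>
     open U \<and> open V \<and> bij_betw f U V \<and> smooth_on U f \<and> smooth_on V (inv_into U f)"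

end

theory Submission
  imports Defs
begin

text \<open>
  The boundary arc between two consecutive vertices contains no other vertex, so by connectedness it
  stays in one facet, which is therefore the segment \<open>[v k, v (k + 1)]\<close>.  Consequently
  \<open>P = {p. \<forall>k. X k p < 1}\<close> for the first coordinate \<open>X k\<close> of \<open>L k\<close>, the sectors \<open>\<bar>Y k\<bar> \<le> X k\<close> cover the plane, and
  two of them meet only in rays through common vertices, where the local formulas agree.  The map
  glued from the formulas with \<open>tanh\<close> is a continuous injection of the plane with image \<open>P\<close>, and
  invariance of domain makes its inverse \<open>f\<close> a homeomorphism.

  For the metric part put \<open>h k = ln (1 - X k)\<close>.  Up to constants the Hilbert distance is
  \<open>max \<bar>h k p - h k q\<bar>\<close>.  Inside one sector these increments are comparable with the
  increments of \<open>artanh (X k)\<close> and \<open>artanh (Y k)\<close>, because the functions \<open>1 - X j\<close> and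
  \<open>1 - X k\<close>, \<open>1 \<plusminus> Y k\<close> are combinations of each other without large cancellation.  Both Lipschitz
  estimates then extend to pairs of points in different sectors along straight segments, which are
  geodesics for the norm and, parametrised by Hilbert arc length, for the Hilbert metric.
\<close>

section \<open>Edges of a polygon with cyclically ordered vertices\<close>

text \<open>The comparison behind the metric part is explicit: if \<open>M\<close> is the largest of
  the numbers \<open>\<bar>h k p - h k q\<bar>\<close>, then
  \<open>M / 2 \<le> hilbert_dist P p q \<le> M\<close>. A chord ends at \<open>a\<close> and
  \<open>b\<close> on edges \<open>i\<close> and \<open>j\<close>. Along it \<open>1 - X i\<close>
  and \<open>1 - X j\<close> are proportional to the parameter \<open>s\<close> and to
  \<open>1 - s\<close>, so the increments of \<open>h i\<close> and \<open>h j\<close> are exactly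
  the two summands of the logarithm of the cross ratio. The obstacle is that logarithms of different
  affine functions are comparable only while the cancellation in the linear relations between them
  stays bounded. Inside one sector this is guaranteed by
  \<open>0 \<le> X k \<plusminus> Y k\<close>, so all comparisons are made there. Lipschitz bounds
  on pieces glue only along geodesics of the domain of the map. Therefore one inequality is proved
  for the inverse map, whose domain is the plane with its norm, and the other one for
  \<open>f\<close> itself, whose domain is \<open>P\<close> with the Hilbert metric.\<close>

lemma connected_subset_one_closed:
  assumes "connected C" "C \<noteq> {}" "finite \<F>" "\<And>F. F \<in> \<F> \<Longrightarrow> closed F" "C \<subseteq> \<Union>\<F>"
    and disj: "\<And>F F'. \<lbrakk>F \<in> \<F>; F' \<in> \<F>; F \<noteq> F'\<rbrakk> \<Longrightarrow> C \<inter> F \<inter> F' = {}"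
  obtains F where "F \<in> \<F>" "C \<subseteq> F"
proof -
  obtain c F where c: "c \<in> C" "F \<in> \<F>" "c \<in> F" using assms by blast
  have "closed F" "closed (\<Union>(\<F> - {F}))"
    using assms(3,4) c by auto
  moreover have "C \<subseteq> F \<union> \<Union>(\<F> - {F})" using assms(5) by auto
  moreover have "F \<inter> \<Union>(\<F> - {F}) \<inter> C = {}" using disj c by blast
  ultimately have "F \<inter> C = {} \<or> \<Union>(\<F> - {F}) \<inter> C = {}"
    using connected_closedD[OF assms(1)] by blast
  then have "C \<subseteq> F" using c assms(5) by blast
  with c that show thesis by blast
qed

lemma edge_polygon_segment:
  fixes K :: "(real \<times> real) set"
  assumes K: "polytope K" "interior K \<noteq> {}" and F: "F facet_of K"
  obtains a b where "F = closed_segment a b" "a \<noteq> b" "a extreme_point_of K" "b extreme_point_of K"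
proof -
  have face: "F face_of K" and dim: "aff_dim F = 1" and ne: "F \<noteq> {}"
    using F K(2) by (auto simp: facet_of_def aff_dim_nonempty_interior)
  have "polytope F" using K(1) face face_of_polytope_polytope by blast
  then have "compact F" "convex F" by (auto simp: polytope_imp_compact polytope_imp_convex)
  moreover have "collinear F" using dim by (simp add: collinear_aff_dim)
  ultimately obtain a b where ab: "F = closed_segment a b"
    using compact_convex_collinear_segment ne by blast
  then have "a \<noteq> b" using dim by auto
  moreover have "a extreme_point_of F" "b extreme_point_of F"
    by (auto simp: ab extreme_point_of_segment)
  then have "a extreme_point_of K" "b extreme_point_of K"
    using extreme_point_of_face[OF face] by auto
  ultimately show thesis using that ab by blast
qed

text \<open>A common point of two facets that is not a vertex would lie in the relative interior of
  the first facet. This would make the first facet a proper face of the second, although their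
  dimensions agree. So the facets are pairwise disjoint closed sets once the vertices are
  removed.\<close>

lemma connected_boundary_subset_facet:
  fixes K :: "(real \<times> real) set"
  assumes K: "polytope K" "interior K \<noteq> {}"
    and C: "connected C" "C \<noteq> {}" "C \<subseteq> frontier K" "\<And>x. x \<in> C \<Longrightarrow> \<not> x extreme_point_of K"
  obtains F where "F facet_of K" "C \<subseteq> F"
proof -
  have fr: "frontier K = \<Union>{F. F facet_of K}"
    using rel_frontier_of_polyhedron[of K] rel_frontier_nonempty_interior[OF K(2)] K(1)
      polytope_imp_polyhedron by metis
  have "C \<inter> F \<inter> F' = {}" if F: "F facet_of K" "F' facet_of K" "F \<noteq> F'" for F F'
  proof (rule ccontr)
    assume "C \<inter> F \<inter> F' \<noteq> {}"
    then obtain c where c: "c \<in> C" "c \<in> F" "c \<in> F'" by blast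
    obtain a b where ab: "F = closed_segment a b" "a \<noteq> b" "a extreme_point_of K" "b extreme_point_of K"
      using edge_polygon_segment[OF K F(1)] by metis
    have "c \<noteq> a" "c \<noteq> b" using C(4) c(1) ab(3,4) by blast+
    then have "c \<in> rel_interior F"
      using c ab by (simp add: rel_interior_closed_segment open_segment_def)
    then have "F \<subseteq> F'"
      using subset_of_face_of[of F' K F] F c facet_of_imp_face_of facet_of_imp_subset by blast
    then have "F face_of F'"
      using F face_of_face facet_of_imp_face_of by blast
    then have "aff_dim F < aff_dim F'"
      using face_of_aff_dim_lt F face_of_imp_convex facet_of_imp_face_of by blast
    then show False using F by (simp add: facet_of_def)
  qed
  then have disj: "\<And>F F'. \<lbrakk>F \<in> {F. F facet_of K}; F' \<in> {F. F facet_of K}; F \<noteq> F'\<rbrakk> \<Longrightarrow> C \<inter> F \<inter> F' = {}"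
    by simp
  have clo: "\<And>F. F \<in> {F. F facet_of K} \<Longrightarrow> closed F"
    using polytope_imp_closed[OF face_of_polytope_polytope[OF K(1) facet_of_imp_face_of]] by blast
  obtain F where "F \<in> {F. F facet_of K}" "C \<subseteq> F"
    by (rule connected_subset_one_closed[OF C(1,2) finite_polytope_facets[OF K(1)] clo C(3)[unfolded fr] disj])
  then show thesis using that by simp
qed

lemma cyclic_edges:
  fixes K :: "(real \<times> real) set" and v :: "nat \<Rightarrow> real \<times> real"
  assumes K: "polytope K" "interior K \<noteq> {}" and n: "n \<ge> 2"
    and ext: "v ` {1..n} = {x. x extreme_point_of K}"
    and cyc: "cyclically_ordered_in (frontier K) n v" and v: "v (n + 1) = v 1"
  shows "inj_on v {1..n}"
    and "k \<in> {1..n} \<Longrightarrow> closed_segment (v k) (v (k + 1)) \<subseteq> frontier K"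
    and "x \<in> frontier K \<Longrightarrow> \<exists>k\<in>{1..n}. x \<in> closed_segment (v k) (v (k + 1))"
proof -
  obtain g \<tau> where g: "path g" "loop_free g" "g 1 = g 0" "g ` {0..1} = frontier K"
    and mono: "strict_mono_on {1..n} \<tau>"
    and \<tau>': "\<forall>k\<in>{1..n}. 0 \<le> \<tau> k \<and> \<tau> k < 1 \<and> g (\<tau> k) = v k"
    using cyc unfolding cyclically_ordered_in_def simple_path_def pathfinish_def pathstart_def path_image_def
    by auto
  from \<tau>' have \<tau>: "0 \<le> \<tau> k \<and> \<tau> k < 1 \<and> g (\<tau> k) = v k" if "k \<in> {1..n}" for k
    using that by blast
  have g_inj: "s = t" if "g s = g t" "0 \<le> s" "s < 1" "0 \<le> t" "t < 1" for s t
    using g(2) that unfolding loop_free_def by force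
  show inj: "inj_on v {1..n}"
  proof (rule inj_onI)
    fix i j assume ij: "i \<in> {1..n}" "j \<in> {1..n}" "v i = v j"
    then have "\<tau> i = \<tau> j" using \<tau>[OF ij(1)] \<tau>[OF ij(2)] g_inj[of "\<tau> i" "\<tau> j"] by simp
    then show "i = j" using inj_onD[OF strict_mono_on_imp_inj_on[OF mono]] ij(1,2) by blast
  qed
  \<comment> \<open>The loop is run through twice, so that the arc from \<open>v n\<close> back to
    \<open>v 1\<close> also belongs to an interval of parameters, which ends at
    \<open>\<sigma> (n + 1) = \<tau> 1 + 1\<close>.\<close>
  define G where "G t = (if t \<le> 1 then g t else g (t - 1))" for t
  define \<sigma> where "\<sigma> k = (if k \<le> n then \<tau> k else \<tau> 1 + 1)" for k
  have "continuous_on {0..1} g" using g(1) by (simp add: path_def)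
  then have contG: "continuous_on {0..2} G"
  proof -
    have "continuous_on ({0..1} \<union> {1..2}) (\<lambda>t. if t \<le> 1 then g t else g (t - 1))"
      by (rule continuous_on_cases)
        (use \<open>continuous_on {0..1} g\<close> g(3) in
          \<open>auto intro!: continuous_on_compose2[of "{0..1}" g] continuous_intros\<close>)
    moreover have "{0..1} \<union> {1..2} = {0..2::real}" by auto
    ultimately show ?thesis unfolding G_def by (simp add: fun_eq_iff)
  qed
  have \<sigma>: "0 \<le> \<sigma> k" "\<sigma> (k + 1) < 2" "G (\<sigma> k) = v k" "G (\<sigma> (k + 1)) = v (k + 1)" "\<sigma> k < \<sigma> (k + 1)"
    if k: "k \<in> {1..n}" for k
  proof -
    have 1: "0 \<le> \<tau> 1" "\<tau> 1 < 1" "g (\<tau> 1) = v 1" using \<tau>[of 1] n by auto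
    show "0 \<le> \<sigma> k" "G (\<sigma> k) = v k" using \<tau>[OF k] k by (auto simp: \<sigma>_def G_def)
    show "\<sigma> (k + 1) < 2"
    proof (cases "k = n")
      case True then show ?thesis using 1 by (simp add: \<sigma>_def)
    next
      case False then show ?thesis using \<tau>[of "k+1"] k by (simp add: \<sigma>_def)
    qed
    show "G (\<sigma> (k + 1)) = v (k + 1)"
    proof (cases "k = n")
      case True then show ?thesis using 1 v g(3) by (auto simp: \<sigma>_def G_def)
    next
      case False then show ?thesis using \<tau>[of "k+1"] k by (auto simp: \<sigma>_def G_def)
    qed
    show "\<sigma> k < \<sigma> (k + 1)"
    proof (cases "k = n")
      case True then show ?thesis using 1 \<tau>[OF k] by (simp add: \<sigma>_def)
    next
      case False then show ?thesis using strict_mono_onD[OF mono, of k "k+1"] k by (simp add: \<sigma>_def)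
    qed
  qed
  have G_img: "G t \<in> frontier K" if "0 \<le> t" "t \<le> 2" for t
    unfolding G_def g(4)[symmetric] using that by auto
  have edge: "closed_segment (v k) (v (k + 1)) facet_of K \<and>
     G ` {\<sigma> k<..<\<sigma> (k + 1)} \<subseteq> closed_segment (v k) (v (k + 1))" if k: "k \<in> {1..n}" for k
  proof -
    let ?J = "{\<sigma> k<..<\<sigma> (k + 1)}"
    have sub: "{\<sigma> k..\<sigma> (k + 1)} \<subseteq> {0..2}" using \<sigma>[OF k] by auto
    have notv: "G t \<noteq> v j" if "t \<in> ?J" "j \<in> {1..n}" for t j
    proof
      assume "G t = v j"
      then have eq: "G t = g (\<tau> j)" using \<tau> that by simp
      \<comment> \<open>Injectivity of \<open>g\<close> on one period identifies \<open>t\<close>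
        with \<open>\<tau> j\<close> up to the period. The order of the \<open>\<tau> j\<close> then
        excludes both possibilities.\<close>
      have t: "t = \<tau> j \<or> t = \<tau> j + 1"
      proof (cases "t < 1")
        case True
        then show ?thesis using eq g_inj[of t "\<tau> j"] \<tau>[of j] that \<sigma>(1)[OF k] by (auto simp: G_def)
      next
        case False
        then have "G t = g (t - 1)" using g(3) by (auto simp: G_def)
        then show ?thesis using eq g_inj[of "t - 1" "\<tau> j"] \<tau>[of j] that \<sigma>(2)[OF k] False
          by (auto simp: G_def)
      qed
      have tn: "\<tau> i \<le> \<tau> i'" if "i \<in> {1..n}" "i' \<in> {1..n}" "i \<le> i'" for i i'
        using strict_mono_onD[OF mono, of i i'] that by (cases "i = i'") auto
      show False
      proof (cases "k = n")
        case True
        then show False using t that k tn[of j n] tn[of 1 j] n by (auto simp: \<sigma>_def)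
      next
        case False
        have "\<tau> (k + 1) < 1" "0 \<le> \<tau> j" using \<tau>[of "k+1"] \<tau>[of j] False k that by auto
        moreover have "j \<le> k \<or> k + 1 \<le> j" by linarith
        ultimately show False using t that k tn[of j k] tn[of "k+1" j] False by (auto simp: \<sigma>_def)
      qed
    qed
    have "connected (G ` ?J)"
      by (rule connected_continuous_image[OF continuous_on_subset[OF contG]]) (use sub in auto)
    moreover have "G ` ?J \<noteq> {}" using \<sigma>[OF k] by auto
    moreover have "G ` ?J \<subseteq> frontier K" using G_img sub by auto
    moreover have "\<not> x extreme_point_of K" if "x \<in> G ` ?J" for x
    proof -
      have "x \<notin> v ` {1..n}" using notv that by (metis imageE)
      then show ?thesis unfolding ext by simp
    qed
    ultimately obtain F where F: "F facet_of K" "G ` ?J \<subseteq> F"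
      by (rule connected_boundary_subset_facet[OF K])
    have clF: "closed F"
      using polytope_imp_closed[OF face_of_polytope_polytope[OF K(1) facet_of_imp_face_of[OF F(1)]]] .
    have "G ` closure ?J \<subseteq> closure F"
      by (rule image_closure_subset)
        (use \<sigma>[OF k] sub clF F closure_closed[OF clF] in \<open>auto intro: continuous_on_subset[OF contG]\<close>)
    then have "G ` {\<sigma> k..\<sigma> (k + 1)} \<subseteq> F"
      using \<sigma>(5)[OF k] clF by (simp add: closure_greaterThanLessThan)
    then have "G (\<sigma> k) \<in> F" "G (\<sigma> (k + 1)) \<in> F"
      using \<sigma>(5)[OF k] by (auto simp: image_subset_iff)
    then have in_F: "v k \<in> F" "v (k + 1) \<in> F"
      using \<sigma>(3,4)[OF k] by simp_all
    obtain a b where ab: "F = closed_segment a b" "a \<noteq> b"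
      using edge_polygon_segment[OF K F(1)] by metis
    \<comment> \<open>The segment \<open>F\<close> has only two extreme points, so two distinct
      vertices of \<open>K\<close> lying on it are its ends. For \<open>k = n\<close> the vertices
      in question are \<open>v n\<close> and \<open>v 1\<close>, which differ because
      \<open>n \<ge> 2\<close>.\<close>
    have vk: "v k \<in> v ` {1..n}" "v (k + 1) \<in> v ` {1..n}" "v k \<noteq> v (k + 1)"
      using k v n inj_onD[OF inj, of k "k + 1"] inj_onD[OF inj, of k 1] by (cases "k = n"; force)+
    then have "v k extreme_point_of F" "v (k + 1) extreme_point_of F"
      using extreme_point_of_face[OF facet_of_imp_face_of[OF F(1)]] in_F ext by auto
    then have "F = closed_segment (v k) (v (k + 1))"
      using ab vk(3) closed_segment_commute by (auto simp: extreme_point_of_segment)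
    with F show ?thesis by blast
  qed
  show "closed_segment (v k) (v (k + 1)) \<subseteq> frontier K" if "k \<in> {1..n}"
    using edge[OF that] rel_frontier_of_polyhedron[of K] rel_frontier_nonempty_interior[OF K(2)] K(1)
      polytope_imp_polyhedron by blast
  show "\<exists>k\<in>{1..n}. x \<in> closed_segment (v k) (v (k + 1))" if x: "x \<in> frontier K"
  proof -
    obtain s where s: "0 \<le> s" "s \<le> 1" "x = g s" using x g(4) by force
    \<comment> \<open>The parameter is moved to the half-open period from \<open>\<tau> 1\<close> to
      \<open>\<tau> 1 + 1\<close>, which the intervals from \<open>\<sigma> k\<close> to
      \<open>\<sigma> (k + 1)\<close> partition. The second shift, to \<open>t'\<close>, takes
      effect only for \<open>s = 1\<close> and \<open>\<tau> 1 = 0\<close>, where \<open>t\<close>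
      is the excluded right end.\<close>
    define t where "t = (if s < \<tau> 1 then s + 1 else s)"
    have t: "\<tau> 1 \<le> t" "t < \<tau> 1 + 1 \<or> t = 1" "G t = x"
      using s \<tau>[of 1] n g(3) by (auto simp: t_def G_def)
    define t' where "t' = (if t < \<tau> 1 + 1 then t else t - 1)"
    have "\<tau> 1 = 0" if "\<not> t < \<tau> 1 + 1" using t that \<tau>[of 1] n by auto
    then have t': "\<tau> 1 \<le> t'" "t' < \<tau> 1 + 1" "G t' = x"
      using t \<tau>[of 1] n g(3) by (auto simp: t'_def G_def)
    define k where "k = Max {k \<in> {1..n}. \<sigma> k \<le> t'}"
    have "1 \<in> {k \<in> {1..n}. \<sigma> k \<le> t'}" using t' n by (auto simp: \<sigma>_def)
    then have k: "k \<in> {k \<in> {1..n}. \<sigma> k \<le> t'}" and kmax: "\<And>j. j \<in> {k \<in> {1..n}. \<sigma> k \<le> t'} \<Longrightarrow> j \<le> k"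
      unfolding k_def by (intro Max_in, auto)
    have "t' < \<sigma> (k + 1)"
    proof (cases "k = n")
      case True then show ?thesis using t' by (simp add: \<sigma>_def)
    next
      case False then show ?thesis using kmax[of "k + 1"] k by force
    qed
    then have "t' = \<sigma> k \<or> t' \<in> {\<sigma> k<..<\<sigma> (k + 1)}" using k by auto
    then have "x \<in> closed_segment (v k) (v (k + 1))"
      using edge[of k] \<sigma>(3)[of k] t' k by auto
    then show ?thesis using k by blast
  qed
qed

section \<open>Functions of class \<open>C\<^sup>k\<close>\<close>

lemma Ck_on_cong:
  assumes "open S" "\<And>x. x \<in> S \<Longrightarrow> f x = g x" "Ck_on m S f"
  shows "Ck_on m S g"
  using assms(2,3)
proof (induction m arbitrary: f g)
  case 0
  then show ?case by (metis Ck_on.simps(1) continuous_on_cong)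
next
  case (Suc m)
  have D: "(g has_derivative frechet_derivative f (at x)) (at x)" if "x \<in> S" for x
  proof (rule has_derivative_transform_within_open[OF _ assms(1) that])
    show "(f has_derivative frechet_derivative f (at x)) (at x)"
      using Suc.prems(2) that frechet_derivative_works by auto
  qed (use Suc.prems(1) in auto)
  have "Ck_on m S (\<lambda>x. frechet_derivative g (at x) h)" for h
    by (rule Suc.IH[of "\<lambda>x. frechet_derivative f (at x) h"])
      (use Suc.prems frechet_derivative_at[OF D] in auto)
  with D show ?case by (auto simp: differentiable_def)
qed

lemma Ck_on_UN:
  assumes "\<And>i. i \<in> I \<Longrightarrow> open (S i)" "\<And>i. i \<in> I \<Longrightarrow> Ck_on m (S i) f"
  shows "Ck_on m (\<Union>i\<in>I. S i) f"
  using assms(2)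
proof (induction m arbitrary: f)
  case 0
  then show ?case using assms(1) by (auto intro: continuous_on_open_UN)
next
  case (Suc m)
  then show ?case by auto
qed

lemma Ck_on_add:
  assumes "open S" "Ck_on m S f" "Ck_on m S g"
  shows "Ck_on m S (\<lambda>x. f x + g x)"
  using assms(2,3)
proof (induction m arbitrary: f g)
  case 0
  then show ?case by (auto intro: continuous_on_add)
next
  case (Suc m)
  have D: "((\<lambda>x. f x + g x) has_derivative
      (\<lambda>h. frechet_derivative f (at x) h + frechet_derivative g (at x) h)) (at x)" if "x \<in> S" for x
    using Suc.prems that frechet_derivative_works by (auto intro!: has_derivative_add)
  have "Ck_on m S (\<lambda>x. frechet_derivative (\<lambda>x. f x + g x) (at x) h)" for h
    by (rule Ck_on_cong[OF assms(1) _ Suc.IH[of "\<lambda>x. frechet_derivative f (at x) h" "\<lambda>x. frechet_derivative g (at x) h"]])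
      (use Suc.prems in \<open>simp_all add: frechet_derivative_at[OF D, symmetric]\<close>)
  with D show ?case by (auto simp: differentiable_def)
qed

text \<open>A directional derivative of a ridge function is again a ridge function: \<open>i\<close>
  rises by one and the vector \<open>w\<close> is multiplied by the number \<open>l h\<close>. A
  sequence \<open>g\<close> of successive derivatives thus makes the induction close up without
  product or chain rules for \<open>Ck_on\<close>.\<close>

lemma Ck_on_ridge:
  fixes g :: "nat \<Rightarrow> real \<Rightarrow> real" and l :: "'a::euclidean_space \<Rightarrow> real" and w :: "'b::euclidean_space"
  assumes "open S" "linear l" "l ` S \<subseteq> I"
    and g: "\<And>i x. x \<in> I \<Longrightarrow> (g i has_real_derivative g (Suc i) x) (at x)"
  shows "Ck_on m S (\<lambda>x. g i (l x) *\<^sub>R w)"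
proof (induction m arbitrary: i w)
  case 0
  have "continuous_on I (g i)"
    using g by (meson DERIV_isCont continuous_at_imp_continuous_on)
  then have "continuous_on S (\<lambda>x. g i (l x))"
    using assms(2,3) continuous_on_compose2 linear_continuous_on linear_conv_bounded_linear by blast
  then show ?case by (auto intro!: continuous_intros)
next
  case (Suc m)
  have D: "((\<lambda>x. g i (l x) *\<^sub>R w) has_derivative (\<lambda>h. (g (Suc i) (l x) * l h) *\<^sub>R w)) (at x)"
    if "x \<in> S" for x
  proof -
    have "(l has_derivative l) (at x)"
      using assms(2) linear_imp_has_derivative by blast
    moreover have "(g i has_derivative (\<lambda>h. g (Suc i) (l x) * h)) (at (l x))"
      using g[of "l x" i] that assms(3) by (auto simp: has_field_derivative_def)
    ultimately have "((\<lambda>x. g i (l x)) has_derivative (\<lambda>h. g (Suc i) (l x) * l h)) (at x)"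
      by (rule has_derivative_compose)
    then show ?thesis by (rule has_derivative_scaleR_left)
  qed
  have "Ck_on m S (\<lambda>x. frechet_derivative (\<lambda>x. g i (l x) *\<^sub>R w) (at x) h)" for h
    by (rule Ck_on_cong[OF assms(1) _ Suc.IH[of "Suc i" "l h *\<^sub>R w"]])
      (simp add: frechet_derivative_at[OF D, symmetric])
  with D show ?case by (auto simp: differentiable_def)
qed

lemma tanh_iterated_derivatives:
  "\<exists>g::nat \<Rightarrow> real \<Rightarrow> real. g 0 = tanh \<and> (\<forall>i x. (g i has_real_derivative g (Suc i) x) (at x))"
proof -
  \<comment> \<open>As the derivative of \<open>tanh\<close> is \<open>1 - tanh ^ 2\<close>,
    differentiation acts on polynomials in \<open>tanh\<close> by sending \<open>q\<close> to
    \<open>pderiv q\<close> times the polynomial 1 - x^2.\<close>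
  define p :: "nat \<Rightarrow> real poly" where "p i = ((\<lambda>q. pderiv q * [:1, 0, -1:]) ^^ i) [:0, 1:]" for i
  define g where "g i x = poly (p i) (tanh x)" for i and x :: real
  have "(g i has_real_derivative g (Suc i) x) (at x)" for i x
  proof -
    have "(tanh has_real_derivative 1 - tanh x ^ 2) (at x)"
      by (auto intro!: derivative_eq_intros)
    from DERIV_chain2[OF poly_DERIV this, of "p i"] show ?thesis
      unfolding g_def by (simp add: p_def power2_eq_square algebra_simps)
  qed
  moreover have "g 0 = tanh" by (simp add: g_def p_def fun_eq_iff)
  ultimately show ?thesis by blast
qed

lemma artanh_iterated_derivatives:
  "\<exists>g::nat \<Rightarrow> real \<Rightarrow> real. g 0 = artanh \<and>
     (\<forall>i. \<forall>x\<in>{-1<..<1}. (g i has_real_derivative g (Suc i) x) (at x))"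
proof -
  \<comment> \<open>The derivative 1/(1 - x^2) of \<open>artanh\<close> splits into the partial
    fractions 1/(1 + x) and 1/(1 - x), each with weight 1/2. Differentiating these \<open>j\<close>
    times gives the formula.\<close>
  define g :: "nat \<Rightarrow> real \<Rightarrow> real" where "g i x = (case i of 0 \<Rightarrow> artanh x
      | Suc j \<Rightarrow> fact j / 2 * ((-1) ^ j * inverse (1 + x) ^ Suc j + inverse (1 - x) ^ Suc j))" for i x
  have "(g i has_real_derivative g (Suc i) x) (at x)" if x: "x \<in> {-1<..<1}" for i x
  proof (cases i)
    case 0
    have "g (Suc 0) x = 1 / (1 - x ^ 2)" using x by (simp add: g_def field_simps power2_eq_square)
    moreover have "g 0 = artanh" by (simp add: g_def fun_eq_iff)
    ultimately show ?thesis using 0 x artanh_real_has_field_derivative[of x UNIV] by auto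
  next
    case (Suc j)
    have *: "((\<lambda>x. inverse (1 + c * x) ^ Suc j) has_real_derivative
        - (c * real (Suc j) * inverse (1 + c * x) ^ Suc (Suc j))) (at x)" if "1 + c * x \<noteq> 0" for c
    proof -
      have "((\<lambda>x. 1 + c * x) has_real_derivative c) (at x)"
        by (auto intro!: derivative_eq_intros)
      then show ?thesis
        by (rule DERIV_cong[OF DERIV_power[OF DERIV_inverse_fun]])
          (use that in \<open>auto simp: field_simps\<close>)
    qed
    have 1: "((\<lambda>x. inverse (1 + x) ^ Suc j) has_real_derivative - real (Suc j) * inverse (1 + x) ^ Suc (Suc j)) (at x)"
      using *[of 1] x by (simp add: algebra_simps)
    have 2: "((\<lambda>x. inverse (1 - x) ^ Suc j) has_real_derivative real (Suc j) * inverse (1 - x) ^ Suc (Suc j)) (at x)"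
      using *[of "-1"] x by (simp add: algebra_simps)
    have "((\<lambda>x. fact j / 2 * ((-1) ^ j * inverse (1 + x) ^ Suc j + inverse (1 - x) ^ Suc j)) has_real_derivative
       fact j / 2 * ((-1) ^ j * (- real (Suc j) * inverse (1 + x) ^ Suc (Suc j))
         + real (Suc j) * inverse (1 - x) ^ Suc (Suc j))) (at x)"
      by (intro DERIV_cmult DERIV_add 1 2)
    moreover have "fact j / 2 * ((-1) ^ j * (- real (Suc j) * inverse (1 + x) ^ Suc (Suc j))
         + real (Suc j) * inverse (1 - x) ^ Suc (Suc j)) = g (Suc i) x"
      unfolding Suc g_def by (simp add: algebra_simps)
    moreover have "g i = (\<lambda>x. fact j / 2 * ((-1) ^ j * inverse (1 + x) ^ Suc j + inverse (1 - x) ^ Suc j))"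
      by (simp add: Suc g_def fun_eq_iff)
    ultimately show ?thesis by (simp only:)
  qed
  moreover have "g 0 = artanh" by (simp add: g_def fun_eq_iff)
  ultimately show ?thesis by blast
qed

section \<open>Chords and the Hilbert distance\<close>

lemma hilbert_dist_eqI:
  assumes "p \<noteq> q" "affine hull {p, q} \<inter> frontier C = {a, b}"
    "p = (1 - s) *\<^sub>R a + s *\<^sub>R b" "q = (1 - t) *\<^sub>R a + t *\<^sub>R b"
    "0 < s" "s < t" "t < 1"
  shows "hilbert_dist C p q = 1 / 2 * ln ((1 - s) / s * (t / (1 - t)))"
proof -
  have "s' = s \<and> t' = t" if h: "affine hull {p, q} \<inter> frontier C = {a', b'}"
      "p = (1 - s') *\<^sub>R a' + s' *\<^sub>R b'" "q = (1 - t') *\<^sub>R a' + t' *\<^sub>R b'"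
      "0 < s'" "s' < t'" "t' < 1" for a' b' s' t'
  proof -
    have ne: "b - a \<noteq> 0" using assms(1,3,4) by (auto simp: algebra_simps)
    have par: "x = y" if "(1 - x) *\<^sub>R a + x *\<^sub>R b = (1 - y) *\<^sub>R a + y *\<^sub>R b" for x y
    proof -
      have "(x - y) *\<^sub>R (b - a) = 0" using that by (simp add: algebra_simps)
      then show ?thesis using ne by simp
    qed
    have "{a', b'} = {a, b}" using h(1) assms(2) by simp
    \<comment> \<open>The intersection with the frontier is an unordered pair. Exchanging the labels
      would replace \<open>s\<close> and \<open>t\<close> by \<open>1 - s\<close> and
      \<open>1 - t\<close>, which reverses their order.\<close>
    then consider "a' = a" "b' = b" | "a' = b" "b' = a" by (auto simp: doubleton_eq_iff)
    then show ?thesis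
    proof cases
      case 1 then show ?thesis using par h(2,3) assms(3,4) by metis
    next
      case 2
      have "s = 1 - s'" using h(2) assms(3) unfolding 2 by (intro par) (simp add: algebra_simps)
      moreover have "t = 1 - t'" using h(3) assms(4) unfolding 2 by (intro par) (simp add: algebra_simps)
      ultimately show ?thesis using h(5) assms(6) by linarith
    qed
  qed
  then have "(THE d. \<exists>a b s t.
              affine hull {p, q} \<inter> frontier C = {a, b} \<and>
              p = (1 - s) *\<^sub>R a + s *\<^sub>R b \<and>
              q = (1 - t) *\<^sub>R a + t *\<^sub>R b \<and>
              0 < s \<and> s < t \<and> t < 1 \<and>
              d = 1 / 2 * ln ((1 - s) / s * (t / (1 - t)))) = 1 / 2 * ln ((1 - s) / s * (t / (1 - t)))"
    by (intro the_equality) (use assms in blast)+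
  then show ?thesis using assms(1) by (simp add: hilbert_dist_def)
qed

lemma chord_exists:
  fixes C :: "'a::euclidean_space set"
  assumes C: "open C" "bounded C" "convex C" and pq: "p \<in> C" "q \<in> C" "p \<noteq> q"
  obtains a b s t where "affine hull {p, q} \<inter> frontier C = {a, b}"
    "p = (1 - s) *\<^sub>R a + s *\<^sub>R b" "q = (1 - t) *\<^sub>R a + t *\<^sub>R b"
    "0 < s" "s < t" "t < 1"
    "\<forall>u\<in>{0<..<1}. (1 - u) *\<^sub>R a + u *\<^sub>R b \<in> C"
proof -
  define z where "z e = p + e *\<^sub>R (q - p)" for e :: real
  have int: "interior C = C" using C by (simp add: interior_open)
  obtain d where d: "0 < d" "z d \<in> frontier C" "\<And>e. \<lbrakk>0 \<le> e; e < d\<rbrakk> \<Longrightarrow> z e \<in> C"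
    using ray_to_frontier[OF C(2), of p "q - p"] pq int unfolding z_def by auto
  obtain c where c: "0 < c" "z (- c) \<in> frontier C" "\<And>e. \<lbrakk>0 \<le> e; e < c\<rbrakk> \<Longrightarrow> z (- e) \<in> C"
    using ray_to_frontier[OF C(2), of p "p - q"] pq int unfolding z_def
    by (auto simp: algebra_simps)
  have mem: "z e \<in> C" if "- c < e" "e < d" for e
    using c(3)[of "- e"] d(3)[of e] that by (cases "0 \<le> e") auto
  have disj: "C \<inter> frontier C = {}" using C by (simp add: frontier_def int)
  have z_conv: "(1 - u) *\<^sub>R z x + u *\<^sub>R z y = z ((1 - u) * x + u * y)" for u x y
    by (simp add: z_def algebra_simps)
  \<comment> \<open>A point strictly between \<open>p\<close> in the open set \<open>C\<close> and a
    point of the closure lies in \<open>C\<close>. So the line meets the frontier only once on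
    either side of \<open>p\<close>, and \<open>q\<close> comes before the exit at
    \<open>d\<close>.\<close>
  have between: False if "0 < r" "r < 1" "e \<noteq> 0" "z (r * e) \<in> frontier C" "z e \<in> closure C" for r e
  proof -
    have "z (r * e) = (1 - r) *\<^sub>R p + r *\<^sub>R z e" by (simp add: z_def algebra_simps)
    then have "z (r * e) \<in> open_segment p (z e)"
      unfolding in_segment using that pq by (intro conjI exI[of _ r]) (auto simp: z_def)
    then show False
      using in_interior_closure_convex_segment[OF C(3), of p "z e"] that int disj pq by auto
  qed
  have z0: "z 0 = p" and z1: "z 1 = q" by (auto simp: z_def)
  have d1: "1 < d"
  proof (rule ccontr)
    assume "\<not> 1 < d"
    then have "d < 1" using d(2) disj z1 pq by (cases "d = 1") auto
    then show False using between[of d 1] d z1 pq closure_subset[of C] by auto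
  qed
  have "affine hull {p, q} = range z"
    unfolding affine_hull_2
  proof (safe, goal_cases)
    case (1 x u v)
    then have u: "u = 1 - v" by simp
    have "u *\<^sub>R p + v *\<^sub>R q = z v" unfolding u by (simp add: z_def algebra_simps)
    then show ?case by auto
  next
    case (2 x e)
    then show ?case by (intro exI[of _ "1 - e"] exI[of _ e]) (simp add: z_def algebra_simps)
  qed
  moreover have "e = d \<or> e = - c" if fe: "z e \<in> frontier C" for e
  proof (rule ccontr)
    assume "\<not> ?thesis"
    then consider "e > d" | "e < - c" using mem[of e] fe disj by force
    then show False
    proof cases
      case 1 then show False using between[of "d / e" e] d fe by (auto simp: frontier_def)
    next
      case 2 then show False using between[of "- c / e" e] c fe by (auto simp: frontier_def field_simps)
    qed
  qed
  ultimately have "affine hull {p, q} \<inter> frontier C = {z (- c), z d}"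
    using c d by auto
  then show thesis
  proof (rule that)
    have cd: "c + d > 0" using c d by simp
    show "p = (1 - c / (c + d)) *\<^sub>R z (- c) + (c / (c + d)) *\<^sub>R z d"
    proof -
      have "c / (c + d) * (c + d) = c" using cd by simp
      then have "(1 - c / (c + d)) * - c + c / (c + d) * d = 0" by argo
      then show ?thesis unfolding z_conv using z0 by simp
    qed
    show "q = (1 - (c + 1) / (c + d)) *\<^sub>R z (- c) + ((c + 1) / (c + d)) *\<^sub>R z d"
    proof -
      have "(c + 1) / (c + d) * (c + d) = c + 1" using cd by simp
      then have "(1 - (c + 1) / (c + d)) * - c + (c + 1) / (c + d) * d = 1" by argo
      then show ?thesis unfolding z_conv using z1 by simp
    qed
    show "\<forall>u\<in>{0<..<1}. (1 - u) *\<^sub>R z (- c) + u *\<^sub>R z d \<in> C"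
    proof
      fix u :: real assume u: "u \<in> {0<..<1}"
      have "u * (c + d) > 0" "(1 - u) * (c + d) > 0" using u cd by auto
      then have "- c < (1 - u) * - c + u * d" "(1 - u) * - c + u * d < d"
        by (auto simp: algebra_simps)
      then show "(1 - u) *\<^sub>R z (- c) + u *\<^sub>R z d \<in> C" unfolding z_conv by (rule mem)
    qed
  qed (use c d d1 in \<open>auto simp: field_simps\<close>)
qed

text \<open>The parameter \<open>u\<close> below is Hilbert arc length on a chord \<open>(1 - \<sigma> u) a + \<sigma> u b\<close>, and \<open>A\<close>, \<open>B\<close> are the
  values at \<open>a\<close>, \<open>b\<close> of an affine function.\<close>

lemma ln_affine_chord_lipschitz:
  fixes A B u u' :: real
  assumes "0 \<le> A" "0 \<le> B" "0 < A + B"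
  defines "\<sigma> \<equiv> \<lambda>u. (1 + tanh u) / 2"
  shows "\<bar>ln ((1 - \<sigma> u') * A + \<sigma> u' * B) - ln ((1 - \<sigma> u) * A + \<sigma> u * B)\<bar> \<le> 2 * \<bar>u' - u\<bar>"
proof -
  define E where "E u = ((1 - \<sigma> u) * A + \<sigma> u * B)" for u
  have \<sigma>: "0 < \<sigma> u" "\<sigma> u < 1" for u
    using tanh_real_bounds[of u] by (auto simp: \<sigma>_def)
  have E: "0 < E u" for u
  proof -
    have "0 \<le> (1 - \<sigma> u) * A" "0 \<le> \<sigma> u * B" using \<sigma>[of u] assms by auto
    moreover have "0 < (1 - \<sigma> u) * A \<or> 0 < \<sigma> u * B" using \<sigma>[of u] assms by (cases "A = 0") auto
    ultimately show ?thesis unfolding E_def by linarith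
  qed
  have D: "((\<lambda>u. ln (E u)) has_real_derivative (1 - (tanh u)^2) / 2 * (B - A) / E u) (at u)" for u
  proof -
    have "E = (\<lambda>u. A + (1 + tanh u) / 2 * (B - A))"
      by (simp add: fun_eq_iff E_def \<sigma>_def field_simps)
    moreover have "((\<lambda>u. A + (1 + tanh u) / 2 * (B - A)) has_real_derivative (1 - (tanh u)^2) / 2 * (B - A)) (at u)"
      by (auto intro!: derivative_eq_intros)
    ultimately have "(E has_real_derivative (1 - (tanh u)^2) / 2 * (B - A)) (at u)" by simp
    from DERIV_chain2[OF DERIV_ln_divide[OF E] this] show ?thesis by (simp add: mult.commute)
  qed
  \<comment> \<open>The derivative of \<open>\<sigma>\<close> is
    \<open>2 * \<sigma> u * (1 - \<sigma> u)\<close>. It decays at both ends of the chord, which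
    compensates for \<open>E\<close> tending to 0 there when \<open>A\<close> or \<open>B\<close>
    vanishes.\<close>
  have bound: "\<bar>(1 - (tanh u)^2) / 2 * (B - A) / E u\<bar> \<le> 2" for u
  proof -
    have "(1 - (tanh u)^2) / 2 = 2 * \<sigma> u * (1 - \<sigma> u)"
      by (simp add: \<sigma>_def field_simps power2_eq_square)
    moreover have "\<bar>2 * \<sigma> u * (1 - \<sigma> u) * (B - A)\<bar> \<le> 2 * E u"
    proof -
      have "\<sigma> u * (1 - \<sigma> u) * \<bar>B - A\<bar> \<le> \<sigma> u * (1 - \<sigma> u) * (A + B)"
        using \<sigma>[of u] assms by (intro mult_left_mono) auto
      also have "\<dots> = \<sigma> u * ((1 - \<sigma> u) * A) + (1 - \<sigma> u) * (\<sigma> u * B)" by (simp add: algebra_simps)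
      also have "\<dots> \<le> 1 * ((1 - \<sigma> u) * A) + 1 * (\<sigma> u * B)"
        using \<sigma>[of u] assms by (intro add_mono mult_right_mono) auto
      finally show ?thesis using \<sigma>[of u] by (simp add: abs_mult E_def)
    qed
    ultimately have "\<bar>(1 - (tanh u)^2) / 2 * (B - A)\<bar> \<le> 2 * E u" by simp
    then show ?thesis using E[of u] by (simp only: abs_divide divide_le_eq) simp
  qed
  have "norm (ln (E u') - ln (E u)) \<le> 2 * norm (u' - u)"
    by (rule field_differentiable_bound[of UNIV _ "\<lambda>u. (1 - (tanh u)^2) / 2 * (B - A) / E u"])
      (use D bound in auto)
  then show ?thesis by (simp add: E_def)
qed

text \<open>The hypothesis on \<open>N\<close> limits the cancellation in \<open>A\<close>.  It bounds \<open>A' / A\<close> by \<open>1 + N (exp \<delta> - 1)\<close>,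
  hence by \<open>exp (N \<delta>)\<close> with Bernoulli's inequality.\<close>

lemma ln_le_of_combination:
  fixes A A' :: real and B B' :: "'i \<Rightarrow> real"
  assumes "finite I" "0 < A" "0 < A'" "\<And>i. i \<in> I \<Longrightarrow> 0 < B i \<and> 0 < B' i"
    and "A = (\<Sum>i\<in>I. c i * B i)" "A' = (\<Sum>i\<in>I. c i * B' i)"
    and "(\<Sum>i\<in>I. \<bar>c i\<bar> * B i) \<le> real N * A" 
    and \<delta>: "\<And>i. i \<in> I \<Longrightarrow> \<bar>ln (B' i) - ln (B i)\<bar> \<le> \<delta>" "0 \<le> \<delta>"
  shows "ln A' - ln A \<le> real N * \<delta>"
proof -
  have B: "\<bar>B' i - B i\<bar> \<le> B i * (exp \<delta> - 1)" if "i \<in> I" for i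
  proof -
    have "B' i = B i * exp (ln (B' i) - ln (B i))" using assms(4)[OF that] by (simp add: exp_diff)
    then have 1: "B' i - B i = B i * (exp (ln (B' i) - ln (B i)) - 1)" by (simp add: algebra_simps)
    have "\<bar>exp x - 1\<bar> \<le> exp \<delta> - 1" if "\<bar>x\<bar> \<le> \<delta>" for x :: real
    proof -
      have "exp x \<le> exp \<delta>" "exp (- \<delta>) \<le> exp x" using that by auto
      moreover have "1 - exp (- \<delta>) \<le> exp \<delta> - 1"
      proof -
        have "2 \<le> exp \<delta> + exp (- \<delta>)" using cosh_real_ge_1[of \<delta>] by (simp add: cosh_field_def)
        then show ?thesis by simp
      qed
      ultimately show ?thesis by linarith
    qed
    from this[OF \<delta>(1)[OF that]] show ?thesis
      using assms(4)[OF that] unfolding 1 by (simp add: abs_mult)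
  qed
  have "A' - A = (\<Sum>i\<in>I. c i * (B' i - B i))" using assms(5,6) by (simp add: algebra_simps sum_subtractf)
  also have "\<dots> \<le> (\<Sum>i\<in>I. \<bar>c i\<bar> * (B i * (exp \<delta> - 1)))"
  proof (rule sum_mono)
    fix i assume "i \<in> I"
    have "c i * (B' i - B i) \<le> \<bar>c i\<bar> * \<bar>B' i - B i\<bar>" by (metis abs_ge_self abs_mult)
    also have "\<dots> \<le> \<bar>c i\<bar> * (B i * (exp \<delta> - 1))" using B[OF \<open>i \<in> I\<close>] by (intro mult_left_mono) auto
    finally show "c i * (B' i - B i) \<le> \<bar>c i\<bar> * (B i * (exp \<delta> - 1))" .
  qed
  also have "\<dots> = (\<Sum>i\<in>I. \<bar>c i\<bar> * B i) * (exp \<delta> - 1)" by (simp add: sum_distrib_right mult.assoc)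
  also have "\<dots> \<le> real N * A * (exp \<delta> - 1)"
    using assms(7) \<delta>(2) by (intro mult_right_mono) auto
  finally have "A' \<le> A * (1 + real N * (exp \<delta> - 1))" by (simp add: algebra_simps)
  also have "\<dots> \<le> A * (1 + (exp \<delta> - 1)) ^ N"
    using assms(2) \<delta>(2) by (intro mult_left_mono Bernoulli_inequality) (auto simp: less_imp_le intro: order_trans[of _ 0])
  also have "\<dots> = A * exp (real N * \<delta>)" by (simp add: exp_of_nat_mult)
  finally have "ln A' \<le> ln (A * exp (real N * \<delta>))" using assms(2,3) by simp
  then show ?thesis using assms(2) by (simp add: ln_mult)
qed

lemma abs_ln_diff_le_of_combination:
  fixes A A' :: real and B B' :: "'i \<Rightarrow> real"
  assumes "finite I" "0 < A" "0 < A'" "\<And>i. i \<in> I \<Longrightarrow> 0 < B i \<and> 0 < B' i"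
    and "A = (\<Sum>i\<in>I. c i * B i)" "A' = (\<Sum>i\<in>I. c i * B' i)"
    and "(\<Sum>i\<in>I. \<bar>c i\<bar> * B i) \<le> real N * A" "(\<Sum>i\<in>I. \<bar>c i\<bar> * B' i) \<le> real N * A'" 
    and \<delta>: "\<And>i. i \<in> I \<Longrightarrow> \<bar>ln (B' i) - ln (B i)\<bar> \<le> \<delta>" "0 \<le> \<delta>"
  shows "\<bar>ln A' - ln A\<bar> \<le> real N * \<delta>"
proof -
  have "ln A' - ln A \<le> real N * \<delta>"
    by (rule ln_le_of_combination[of I A A' B B' c]) (use assms in auto)
  moreover have "ln A - ln A' \<le> real N * \<delta>"
    by (rule ln_le_of_combination[of I A' A B' B c]) (use assms in \<open>auto simp: abs_minus_commute\<close>)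
  ultimately show ?thesis by linarith
qed

section \<open>Estimates for logarithms and Lipschitz maps\<close>

lemma tanh_artanh: "tanh (artanh x) = x" if "\<bar>x\<bar> < 1" for x :: real
proof -
  have E: "exp (- 2 * artanh x) = (1 - x) / (1 + x)"
    using that by (simp add: artanh_def exp_minus)
  show ?thesis unfolding tanh_real_altdef E using that by (simp add: field_simps)
qed

lemma artanh_less_iff: "artanh x < artanh y \<longleftrightarrow> x < y" if "\<bar>x\<bar> < 1" "\<bar>y\<bar> < 1" for x y :: real
  using tanh_real_less_iff[of "artanh x" "artanh y"] that by (simp only: tanh_artanh)

lemma artanh_le_iff: "artanh x \<le> artanh y \<longleftrightarrow> x \<le> y" if "\<bar>x\<bar> < 1" "\<bar>y\<bar> < 1" for x y :: real
  using tanh_real_le_iff[of "artanh x" "artanh y"] that by (simp only: tanh_artanh)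

text \<open>The relations inside a sector have at most three terms. A shorter one is padded with the
  coefficient 0 and the constant function 1.\<close>

lemma abs_ln_diff_le_of_combination3:
  fixes A A' b0 b0' b1 b1' b2 b2' :: real
  assumes "0 < A" "0 < A'" and pos: "0 < b0" "0 < b0'" "0 < b1" "0 < b1'" "0 < b2" "0 < b2'"
    and A: "A = c0 * b0 + c1 * b1 + c2 * b2" "A' = c0 * b0' + c1 * b1' + c2 * b2'"
    and N: "\<bar>c0\<bar> * b0 + \<bar>c1\<bar> * b1 + \<bar>c2\<bar> * b2 \<le> real N * A"
      "\<bar>c0\<bar> * b0' + \<bar>c1\<bar> * b1' + \<bar>c2\<bar> * b2' \<le> real N * A'"
    and \<delta>: "\<bar>ln b0' - ln b0\<bar> \<le> \<delta>" "\<bar>ln b1' - ln b1\<bar> \<le> \<delta>" "\<bar>ln b2' - ln b2\<bar> \<le> \<delta>"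
  shows "\<bar>ln A' - ln A\<bar> \<le> real N * \<delta>"
proof -
  define f :: "real \<Rightarrow> real \<Rightarrow> real \<Rightarrow> nat \<Rightarrow> real"
    where "f x y z i = (if i = 0 then x else if i = 1 then y else z)" for x y z i
  have f: "f x y z 0 = x" "f x y z 1 = y" "f x y z 2 = z" for x y z by (simp_all add: f_def)
  have sum3: "(\<Sum>i\<in>{0, 1, 2::nat}. g i) = g 0 + g 1 + g 2" for g :: "nat \<Rightarrow> real" by simp
  have all3: "Q i" if "i \<in> {0, 1, 2::nat}" "Q 0" "Q 1" "Q 2" for Q i using that by blast
  show ?thesis
  proof (rule abs_ln_diff_le_of_combination[of "{0, 1, 2::nat}" A A' "f b0 b1 b2" "f b0' b1' b2'" "f c0 c1 c2"])
    show "0 < f b0 b1 b2 i \<and> 0 < f b0' b1' b2' i" if "i \<in> {0, 1, 2::nat}" for i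
      by (rule all3[OF that]) (use pos in \<open>simp_all only: f simp_thms\<close>)
    show "\<bar>ln (f b0' b1' b2' i) - ln (f b0 b1 b2 i)\<bar> \<le> \<delta>" if "i \<in> {0, 1, 2::nat}" for i
      by (rule all3[OF that]) (use \<delta> in \<open>simp_all only: f simp_thms\<close>)
    show "0 \<le> \<delta>" using \<delta>(1) by linarith
  qed (use assms(1,2) A N in \<open>simp_all only: sum3 f finite.emptyI finite_insert\<close>)
qed

text \<open>Twice \<open>artanh z\<close> is \<open>ln (1 + z) - ln (1 - z)\<close>, and the two
  logarithms move in opposite directions. Their increments therefore add up in absolute value and
  each of them is bounded by the total.\<close>

lemma ln_diff_le_artanh:
  fixes x y :: real
  assumes "\<bar>x\<bar> < 1" "\<bar>y\<bar> < 1"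
  shows "\<bar>ln (1 - x) - ln (1 - y)\<bar> \<le> 2 * \<bar>artanh x - artanh y\<bar>"
    and "\<bar>ln (1 + x) - ln (1 + y)\<bar> \<le> 2 * \<bar>artanh x - artanh y\<bar>"
    and "2 * \<bar>artanh x - artanh y\<bar> \<le> \<bar>ln (1 + x) - ln (1 + y)\<bar> + \<bar>ln (1 - x) - ln (1 - y)\<bar>"
proof -
  have art: "2 * artanh z = ln (1 + z) - ln (1 - z)" if "\<bar>z\<bar> < 1" for z :: real
  proof -
    have "0 < 1 + z" "0 < 1 - z" using that by auto
    then show ?thesis by (simp add: artanh_def ln_div)
  qed
  have pos: "0 < 1 - x" "0 < 1 - y" "0 < 1 + x" "0 < 1 + y" using assms by auto
  have mono: "ln (1 - x) \<le> ln (1 - y) \<longleftrightarrow> y \<le> x" "ln (1 + y) \<le> ln (1 + x) \<longleftrightarrow> y \<le> x"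
    using pos by simp_all
  have "ln (1 - x) \<le> ln (1 - y) \<and> ln (1 + y) \<le> ln (1 + x) \<or> ln (1 - y) \<le> ln (1 - x) \<and> ln (1 + x) \<le> ln (1 + y)"
    using mono by linarith
  then have "\<bar>ln (1 - x) - ln (1 - y)\<bar> \<le> 2 * \<bar>artanh x - artanh y\<bar> \<and>
    \<bar>ln (1 + x) - ln (1 + y)\<bar> \<le> 2 * \<bar>artanh x - artanh y\<bar> \<and>
    2 * \<bar>artanh x - artanh y\<bar> \<le> \<bar>ln (1 + x) - ln (1 + y)\<bar> + \<bar>ln (1 - x) - ln (1 - y)\<bar>"
    using art[OF assms(1)] art[OF assms(2)]
    by (elim disjE conjE) (intro conjI; simp add: abs_if; linarith)+
  then show "\<bar>ln (1 - x) - ln (1 - y)\<bar> \<le> 2 * \<bar>artanh x - artanh y\<bar>"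
    "\<bar>ln (1 + x) - ln (1 + y)\<bar> \<le> 2 * \<bar>artanh x - artanh y\<bar>"
    "2 * \<bar>artanh x - artanh y\<bar> \<le> \<bar>ln (1 + x) - ln (1 + y)\<bar> + \<bar>ln (1 - x) - ln (1 - y)\<bar>"
    by blast+
qed

text \<open>On the nonnegative side the product (1 + x)(1 - x) decreases, so
  \<open>ln (1 + x)\<close> grows no faster than \<open>ln (1 - x)\<close> falls. One logarithm then
  suffices to control \<open>artanh\<close>, as will be the case for \<open>X k\<close> in its
  sector.\<close>

lemma artanh_diff_le_ln:
  fixes x y :: real
  assumes "0 \<le> x" "x < 1" "0 \<le> y" "y < 1"
  shows "\<bar>artanh x - artanh y\<bar> \<le> \<bar>ln (1 - x) - ln (1 - y)\<bar>"
proof -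
  have *: "\<bar>ln (1 + x) - ln (1 + y)\<bar> \<le> \<bar>ln (1 - x) - ln (1 - y)\<bar>"
    if "0 \<le> x" "x \<le> y" "y < 1" for x y :: real
  proof -
    have pos: "0 < 1 - x" "0 < 1 - y" "0 < 1 + x" "0 < 1 + y" using that by auto
    have "x * x \<le> y * y" using that by (intro mult_mono) auto
    then have "(1 + y) * (1 - y) \<le> (1 + x) * (1 - x)" by (simp add: algebra_simps)
    then have "ln ((1 + y) * (1 - y)) \<le> ln ((1 + x) * (1 - x))" using pos by simp
    then have "ln (1 + y) + ln (1 - y) \<le> ln (1 + x) + ln (1 - x)" using pos by (simp add: ln_mult)
    moreover have "ln (1 + x) \<le> ln (1 + y)" using that pos by simp
    ultimately show ?thesis by linarith
  qed
  have "\<bar>ln (1 + x) - ln (1 + y)\<bar> \<le> \<bar>ln (1 - x) - ln (1 - y)\<bar>"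
    using *[of x y] *[of y x] assms by (cases "x \<le> y") (simp_all add: abs_minus_commute)
  then show ?thesis using ln_diff_le_artanh(3)[of x y] assms by simp
qed

text \<open>Pulling the cover back to a segment reduces the claim to intervals of the real line.
  Norm distances add up along a segment, so passing from piece to piece does not worsen the
  constant.\<close>

lemma lipschitz_on_closed_cover:
  fixes f :: "'a::real_normed_vector \<Rightarrow> 'b::metric_space"
  assumes "finite I" "\<And>i. i \<in> I \<Longrightarrow> closed (S i)" "(\<Union>i\<in>I. S i) = UNIV"
    and lip: "\<And>i. i \<in> I \<Longrightarrow> C-lipschitz_on (S i) f" and "0 \<le> C"
  shows "C-lipschitz_on UNIV f"
proof (rule lipschitz_onI)
  fix x y :: 'a
  define \<phi> where "\<phi> r = x + r *\<^sub>R (y - x)" for r :: real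
  have dist: "dist (\<phi> r) (\<phi> r') = dist x y * dist r r'" for r r'
    by (simp add: \<phi>_def dist_norm norm_minus_commute mult.commute flip: scaleR_diff_left)
  have "(C * dist x y)-lipschitz_on {0..1} (\<lambda>r. f (\<phi> r))"
  proof (rule lipschitz_on_closed_Union)
    show "(C * dist x y)-lipschitz_on (\<phi> -` S i) (\<lambda>r. f (\<phi> r))" if "i \<in> I" for i
    proof (rule lipschitz_onI)
      fix r r' assume "r \<in> \<phi> -` S i" "r' \<in> \<phi> -` S i"
      then have "dist (f (\<phi> r)) (f (\<phi> r')) \<le> C * dist (\<phi> r) (\<phi> r')"
        by (intro lipschitz_onD[OF lip[OF that]]) simp_all
      then show "dist (f (\<phi> r)) (f (\<phi> r')) \<le> C * dist x y * dist r r'" unfolding dist by (simp add: mult.assoc)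
    qed (use \<open>0 \<le> C\<close> in simp)
    show "closed (\<phi> -` S i)" if "i \<in> I" for i
      unfolding \<phi>_def by (intro continuous_closed_vimage assms that continuous_intros)
    show "{0..1} \<subseteq> (\<Union>i\<in>I. \<phi> -` S i)" using assms(3) by blast
  qed (use assms in simp_all)
  from lipschitz_onD[OF this, of 0 1] show "dist (f x) (f y) \<le> C * dist x y"
    by (simp add: \<phi>_def)
qed (fact \<open>0 \<le> C\<close>)

lemma finite_uniform_constant:
  fixes Q :: "'i \<Rightarrow> real \<Rightarrow> bool"
  assumes "finite I" "\<And>i. i \<in> I \<Longrightarrow> \<exists>C\<ge>0. Q i C" "\<And>i C D. i \<in> I \<Longrightarrow> Q i C \<Longrightarrow> C \<le> D \<Longrightarrow> Q i D"
  shows "\<exists>C\<ge>0. \<forall>i\<in>I. Q i C"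
proof -
  obtain c where c: "\<And>i. i \<in> I \<Longrightarrow> 0 \<le> c i \<and> Q i (c i)"
    using assms(2) by metis
  have "Q i (sum c I)" if "i \<in> I" for i
    by (rule assms(3)[OF that, of "c i"]) (use c that assms(1) in \<open>auto intro: member_le_sum\<close>)
  moreover have "0 \<le> sum c I" using c by (intro sum_nonneg) blast
  ultimately show ?thesis by blast
qed

lemma l1_norm_bounds: "norm z \<le> l1_norm z" "l1_norm z \<le> 2 * norm z"
  using norm_fst_le[of "fst z" "snd z"] norm_snd_le[of "snd z" "fst z"] norm_Pair_le[of "fst z" "snd z"]
  by (simp_all add: l1_norm_def)

section \<open>Sectors of a polygon around the origin\<close>

lemma L_map_basis:
  fixes v :: "nat \<Rightarrow> real \<times> real"
  assumes indep: "\<And>s t. s *\<^sub>R v k + t *\<^sub>R v (k + 1) = 0 \<Longrightarrow> s = 0 \<and> t = 0"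
  shows "linear (L_map v k)" "L_map v k (s *\<^sub>R v k + t *\<^sub>R v (k + 1)) = (s + t, t - s)"
    and "p = ((fst (L_map v k p) - snd (L_map v k p)) / 2) *\<^sub>R v k
           + ((fst (L_map v k p) + snd (L_map v k p)) / 2) *\<^sub>R v (k + 1)"
proof -
  obtain a1 a2 b1 b2 where ab: "v k = (a1, a2)" "v (k + 1) = (b1, b2)"
    by (cases "v k", cases "v (k + 1)") auto
  note ab = ab ab(2)[unfolded Suc_eq_plus1[symmetric]]
  define D where "D = a1 * b2 - a2 * b1"
  have "D \<noteq> 0"
  proof
    assume D: "D = 0"
    \<comment> \<open>If the determinant vanishes, the coefficients \<open>b2, - a2\<close> and
      \<open>b1, - a1\<close> both give linear relations between the two vectors, and independence
      makes all four coordinates vanish.\<close>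
    have "a2 = 0 \<and> b2 = 0" using indep[of b2 "- a2"] D by (simp add: ab D_def zero_prod_def algebra_simps)
    moreover have "a1 = 0 \<and> b1 = 0"
      using indep[of b1 "- a1"] D by (simp add: ab D_def zero_prod_def algebra_simps)
    ultimately have "v k = 0" "v (k + 1) = 0" unfolding ab zero_prod_def by simp_all
    then show False using indep[of 1 1] by simp
  qed
  define \<alpha> \<beta> where "\<alpha> p = (fst p * b2 - snd p * b1) / D" and "\<beta> p = (a1 * snd p - a2 * fst p) / D"
    for p :: "real \<times> real"
  have decomp: "p = \<alpha> p *\<^sub>R v k + \<beta> p *\<^sub>R v (k + 1)" for p
  proof -
    have D: "D * \<alpha> p = fst p * b2 - snd p * b1" "D * \<beta> p = a1 * snd p - a2 * fst p"
      using \<open>D \<noteq> 0\<close> by (simp_all add: \<alpha>_def \<beta>_def)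
    have "D *\<^sub>R (\<alpha> p *\<^sub>R v k + \<beta> p *\<^sub>R v (k + 1)) = (D * \<alpha> p) *\<^sub>R (a1, a2) + (D * \<beta> p) *\<^sub>R (b1, b2)"
      by (simp only: ab scaleR_add_right scaleR_scaleR)
    also have "\<dots> = D *\<^sub>R p"
      unfolding D by (simp add: prod_eq_iff D_def algebra_simps)
    finally have "D *\<^sub>R p = D *\<^sub>R (\<alpha> p *\<^sub>R v k + \<beta> p *\<^sub>R v (k + 1))" ..
    then show ?thesis using \<open>D \<noteq> 0\<close> by simp
  qed
  define L where "L p = (\<alpha> p + \<beta> p, \<beta> p - \<alpha> p)" for p
  have unique: "L' p = L p" if "linear L'" "L' (v k) = (1, -1)" "L' (v (k + 1)) = (1, 1)" for L' p
  proof -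
    have "L' p = L' (\<alpha> p *\<^sub>R v k + \<beta> p *\<^sub>R v (k + 1))" by (rule arg_cong[OF decomp])
    also have "\<dots> = \<alpha> p *\<^sub>R (1, -1) + \<beta> p *\<^sub>R (1, 1)"
      using that by (simp add: linear_add linear_scale)
    finally show ?thesis by (simp add: L_def)
  qed
  have lin: "linear L"
    unfolding L_def \<alpha>_def \<beta>_def
    by (rule linearI) (simp_all add: prod_eq_iff add_divide_distrib diff_divide_distrib algebra_simps)
  have coords: "\<alpha> (s *\<^sub>R v k + t *\<^sub>R v (k + 1)) = s" "\<beta> (s *\<^sub>R v k + t *\<^sub>R v (k + 1)) = t" for s t
    using \<open>D \<noteq> 0\<close> by (simp_all add: \<alpha>_def \<beta>_def ab divide_eq_eq) (simp_all add: D_def algebra_simps)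
  have LL: "L (v k) = (1, -1)" "L (v (k + 1)) = (1, 1)"
    using coords[of 1 0] coords[of 0 1] by (simp_all add: L_def)
  have eq: "L_map v k = L"
    unfolding L_map_def
  proof (rule the_equality)
    show "linear L \<and> L (v k) = (1, -1) \<and> L (v (k + 1)) = (1, 1)" using lin LL by blast
    show "L' = L" if "linear L' \<and> L' (v k) = (1, -1) \<and> L' (v (k + 1)) = (1, 1)" for L'
      by (rule ext) (rule unique; use that in blast)
  qed
  show "linear (L_map v k)" using lin eq by simp
  show "L_map v k (s *\<^sub>R v k + t *\<^sub>R v (k + 1)) = (s + t, t - s)"
    unfolding eq L_def coords by simp
  have "(fst (L_map v k p) - snd (L_map v k p)) / 2 = \<alpha> p" "(fst (L_map v k p) + snd (L_map v k p)) / 2 = \<beta> p"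
    by (simp_all add: eq L_def)
  then show "p = ((fst (L_map v k p) - snd (L_map v k p)) / 2) *\<^sub>R v k
           + ((fst (L_map v k p) + snd (L_map v k p)) / 2) *\<^sub>R v (k + 1)"
    by (simp only:) (rule decomp)
qed

locale polygon_around_origin =
  fixes P :: "(real \<times> real) set" and n :: nat and v :: "nat \<Rightarrow> real \<times> real"
  assumes polygon: "open_convex_polygon P n v" and zero_in: "0 \<in> P"
begin

abbreviation X :: "nat \<Rightarrow> real \<times> real \<Rightarrow> real" where "X k p \<equiv> fst (L_map v k p)"
abbreviation Y :: "nat \<Rightarrow> real \<times> real \<Rightarrow> real" where "Y k p \<equiv> snd (L_map v k p)"

text \<open>This is the closed cone spanned by \<open>v k\<close> and \<open>v (k + 1)\<close>: the
  coefficients of \<open>p\<close> in this basis are \<open>(X k p - Y k p) / 2\<close> and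
  \<open>(X k p + Y k p) / 2\<close>.\<close>

definition sector :: "nat \<Rightarrow> (real \<times> real) set" where
  "sector k = {p. \<bar>Y k p\<bar> \<le> X k p}"

lemma P_props: "open P" "bounded P" "convex P" "n \<ge> 3" "v (n + 1) = v 1"
  and interior_P: "interior P = P" and interior_closure_P: "interior (closure P) = P"
  and frontier_closure_P: "frontier (closure P) = frontier P"
  and extreme: "v ` {1..n} = {x. x extreme_point_of closure P}"
proof -
  show P: "open P" "bounded P" "convex P" "n \<ge> 3" "v (n + 1) = v 1"
    and "v ` {1..n} = {x. x extreme_point_of closure P}"
    using polygon by (auto simp: open_convex_polygon_def)
  show "interior P = P" using P by (simp add: interior_open)
  then show "interior (closure P) = P" using P by (simp add: convex_interior_closure)
  then show "frontier (closure P) = frontier P" using P by (simp add: frontier_def interior_open)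
qed

lemma inj_v: "inj_on v {1..n}"
  and edge_subset: "k \<in> {1..n} \<Longrightarrow> closed_segment (v k) (v (k + 1)) \<subseteq> frontier P"
  and frontier_edge: "x \<in> frontier P \<Longrightarrow> \<exists>k\<in>{1..n}. x \<in> closed_segment (v k) (v (k + 1))"
proof -
  have "polytope (closure P)" "interior (closure P) \<noteq> {}" "n \<ge> 2"
    "cyclically_ordered_in (frontier (closure P)) n v"
    using polygon zero_in unfolding interior_closure_P frontier_closure_P open_convex_polygon_def by auto
  note * = cyclic_edges[OF this(1,2,3) extreme this(4) P_props(5), unfolded frontier_closure_P]
  show "inj_on v {1..n}" "k \<in> {1..n} \<Longrightarrow> closed_segment (v k) (v (k + 1)) \<subseteq> frontier P"
   "x \<in> frontier P \<Longrightarrow> \<exists>k\<in>{1..n}. x \<in> closed_segment (v k) (v (k + 1))"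
    using * by blast+
qed

lemma v_eq_iff: "i \<in> {1..n} \<Longrightarrow> j \<in> {1..n} \<Longrightarrow> v i = v j \<longleftrightarrow> i = j"
  using inj_v by (rule inj_on_eq_iff)

text \<open>The injectivity of \<open>v\<close> concerns indices from 1 to \<open>n\<close>. To
  apply it to the end \<open>v (k + 1)\<close> of the last edge, the index \<open>n + 1\<close> has
  to be replaced by 1.\<close>

definition nxt :: "nat \<Rightarrow> nat" where "nxt k = (if k = n then 1 else k + 1)"

lemma nxt: "k \<in> {1..n} \<Longrightarrow> nxt k \<in> {1..n}" "v (k + 1) = v (nxt k)"
  using P_props(4,5) by (auto simp: nxt_def)

lemma v_neq: "k \<in> {1..n} \<Longrightarrow> v k \<noteq> v (k + 1)"
  using nxt[of k] v_eq_iff[of k "nxt k"] P_props(4) by (auto simp: nxt_def split: if_splits)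

lemma v_extreme: "k \<in> {1..n} \<Longrightarrow> v k extreme_point_of closure P" "k \<in> {1..n} \<Longrightarrow> v (k + 1) extreme_point_of closure P"
  using extreme nxt by auto

text \<open>If the line met \<open>P\<close> beyond one end of the edge, that end would lie strictly
  between a point of the open set \<open>P\<close> and a point of its closure. It would then belong
  to \<open>P\<close>, but it is a frontier point.\<close>

lemma edge_line_misses:
  assumes k: "k \<in> {1..n}"
  shows "(1 - u) *\<^sub>R v k + u *\<^sub>R v (k + 1) \<notin> P"
proof
  let ?z = "(1 - u) *\<^sub>R v k + u *\<^sub>R v (k + 1)"
  assume z: "?z \<in> P"
  have cl: "v k \<in> closure P" "v (k + 1) \<in> closure P"
    using v_extreme[OF k] by (auto simp: extreme_point_of_def)
  have disj: "P \<inter> frontier P = {}" by (simp add: frontier_def interior_P)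
  have fr: "v k \<in> frontier P" "v (k + 1) \<in> frontier P" using edge_subset[OF k] by auto
  note seg = in_interior_closure_convex_segment[OF P_props(3), unfolded interior_P, OF z]
  consider "0 \<le> u" "u \<le> 1" | "u < 0" | "1 < u" by linarith
  then show False
  proof cases
    case 1
    then have "?z \<in> closed_segment (v k) (v (k + 1))" by (auto simp: in_segment)
    then show False using edge_subset[OF k] z disj by blast
  next
    case 2
    \<comment> \<open>Solving the formula for \<open>?z\<close> for \<open>v k\<close> gives the
      weight \<open>c\<close> at \<open>?z\<close> and \<open>1 - c\<close> at
      \<open>v (k + 1)\<close>.\<close>
    define c where "c = 1 / (1 - u)"
    have c: "c * (1 - u) = 1" "c * u = c - 1" "0 < c" "c < 1" using 2 by (auto simp: c_def field_simps)
    have "c *\<^sub>R ?z = v k + (c - 1) *\<^sub>R v (k + 1)" by (simp add: scaleR_add_right c(1,2))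
    then have "v k = (1 - (1 - c)) *\<^sub>R ?z + (1 - c) *\<^sub>R v (k + 1)" by (simp add: scaleR_diff_left)
    moreover have "?z \<noteq> v (k + 1)" using z fr disj by (metis disjoint_iff)
    ultimately have "v k \<in> open_segment ?z (v (k + 1))"
      unfolding in_segment using c by (intro conjI exI[of _ "1 - c"]) simp_all
    then have "v k \<in> P" using seg[OF cl(2)] by (rule subsetD[rotated])
    then show False using fr disj by (metis disjoint_iff)
  next
    case 3
    define c where "c = 1 / u"
    have c: "c * (1 - u) = c - 1" "c * u = 1" "0 < c" "c < 1" using 3 by (auto simp: c_def field_simps)
    have "c *\<^sub>R ?z = (c - 1) *\<^sub>R v k + v (k + 1)" by (simp add: scaleR_add_right c(1,2))
    then have "v (k + 1) = (1 - (1 - c)) *\<^sub>R ?z + (1 - c) *\<^sub>R v k" by (simp add: scaleR_diff_left)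
    moreover have "?z \<noteq> v k" using z fr disj by (metis disjoint_iff)
    ultimately have "v (k + 1) \<in> open_segment ?z (v k)"
      unfolding in_segment using c by (intro conjI exI[of _ "1 - c"]) simp_all
    then have "v (k + 1) \<in> P" using seg[OF cl(1)] by (rule subsetD[rotated])
    then show False using fr disj by (metis disjoint_iff)
  qed
qed

text \<open>Dividing a relation with nonzero \<open>s + t\<close> by this sum puts the origin on the
  line through the edge. That line misses \<open>P\<close>, whereas the origin is in
  \<open>P\<close>.\<close>

lemma v_indep:
  assumes k: "k \<in> {1..n}" and st: "s *\<^sub>R v k + t *\<^sub>R v (k + 1) = 0"
  shows "s = 0 \<and> t = 0"
proof (cases "s + t = 0")
  case True
  then have s: "s = - t" by linarith
  have "t *\<^sub>R (v (k + 1) - v k) = 0" using st unfolding s by (simp add: scaleR_diff_right)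
  then have "t = 0" using v_neq[OF k] by simp
  then show ?thesis using s by simp
next
  case False
  have "1 - t / (s + t) = s / (s + t)" using False by (simp add: field_simps)
  then have "(1 - t / (s + t)) *\<^sub>R v k + (t / (s + t)) *\<^sub>R v (k + 1)
     = (1 / (s + t)) *\<^sub>R (s *\<^sub>R v k + t *\<^sub>R v (k + 1))"
    by (simp add: scaleR_add_right)
  also have "\<dots> = 0" unfolding st by simp
  finally have "0 \<notin> P" using edge_line_misses[OF k, of "t / (s + t)"] by simp
  then show ?thesis using zero_in by contradiction
qed

lemma L_linear:
  assumes "k \<in> {1..n}"
  shows "linear (L_map v k)"
  by (rule L_map_basis(1)[OF v_indep[OF assms]])

lemma X_linear: "k \<in> {1..n} \<Longrightarrow> linear (X k)" and Y_linear: "k \<in> {1..n} \<Longrightarrow> linear (Y k)"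
  using linear_compose[OF L_linear linear_fst] linear_compose[OF L_linear linear_snd]
  by (simp_all only: o_def)

lemma XY_comb:
  assumes "k \<in> {1..n}"
  shows "X k (s *\<^sub>R v k + t *\<^sub>R v (k + 1)) = s + t" "Y k (s *\<^sub>R v k + t *\<^sub>R v (k + 1)) = t - s"
  using L_map_basis(2)[OF v_indep[OF assms], where s=s and t=t] by simp_all

lemma decomp:
  assumes "k \<in> {1..n}"
  shows "p = ((X k p - Y k p) / 2) *\<^sub>R v k + ((X k p + Y k p) / 2) *\<^sub>R v (k + 1)"
  by (rule L_map_basis(3)[OF v_indep[OF assms]])

lemma decompI:
  assumes "k \<in> {1..n}" "a = (X k p - Y k p) / 2" "b = (X k p + Y k p) / 2"
  shows "p = a *\<^sub>R v k + b *\<^sub>R v (k + 1)"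
  unfolding assms(2,3) by (rule decomp[OF assms(1)])

lemma XY_v:
  assumes "k \<in> {1..n}"
  shows "X k (v k) = 1" "Y k (v k) = -1" "X k (v (k + 1)) = 1" "Y k (v (k + 1)) = 1"
  using XY_comb[OF assms, of 1 0] XY_comb[OF assms, of 0 1] by auto

lemma XY_add_scale:
  assumes "k \<in> {1..n}"
  shows "X k (s *\<^sub>R p + t *\<^sub>R q) = s * X k p + t * X k q" "Y k (s *\<^sub>R p + t *\<^sub>R q) = s * Y k p + t * Y k q"
    "X k (s *\<^sub>R p) = s * X k p" "Y k (s *\<^sub>R p) = s * Y k p" "X k 0 = 0" "Y k 0 = 0"
  by (simp_all only: linear_add[OF L_linear[OF assms]] linear_scale[OF L_linear[OF assms]]
      linear_0[OF L_linear[OF assms]] fst_add snd_add fst_scaleR snd_scaleR fst_zero snd_zero real_scaleR_def)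

lemma X_less_1:
  assumes k: "k \<in> {1..n}" and p: "p \<in> P"
  shows "X k p < 1"
proof (rule ccontr)
  assume "\<not> X k p < 1"
  then have x: "1 \<le> X k p" by simp
  \<comment> \<open>Shrinking \<open>p\<close> towards the origin keeps it in the convex set
    \<open>P\<close> and brings it onto the edge line, which misses \<open>P\<close>.\<close>
  define q where "q = (1 / X k p) *\<^sub>R p"
  have "q = (1 - 1 / X k p) *\<^sub>R 0 + (1 / X k p) *\<^sub>R p" by (simp add: q_def)
  then have "q \<in> P" using convexD_alt[OF P_props(3) zero_in p, of "1 / X k p"] x by (simp add: q_def)
  moreover have "X k q = 1" using x XY_add_scale[OF k] by (simp add: q_def)
  then have "q = (1 - (1 + Y k q) / 2) *\<^sub>R v k + ((1 + Y k q) / 2) *\<^sub>R v (k + 1)"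
    by (intro decompI[OF k]) (simp_all add: field_simps)
  ultimately show False using edge_line_misses[OF k, of "(1 + Y k q) / 2"] by simp
qed

lemma X_le_1:
  assumes "k \<in> {1..n}" "p \<in> closure P"
  shows "X k p \<le> 1"
proof -
  have "closed {p. X k p \<le> 1}"
    by (intro closed_Collect_le continuous_on_const linear_continuous_on
        X_linear[OF assms(1), unfolded linear_conv_bounded_linear])
  then have "closure P \<subseteq> {p. X k p \<le> 1}"
    using X_less_1[OF assms(1)] by (intro closure_minimal) (auto simp: less_imp_le)
  with assms show ?thesis by auto
qed

lemma X_v_le_1: "k \<in> {1..n} \<Longrightarrow> j \<in> {1..n} \<Longrightarrow> X k (v j) \<le> 1" "k \<in> {1..n} \<Longrightarrow> j \<in> {1..n} \<Longrightarrow> X k (v (j + 1)) \<le> 1"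
  using X_le_1 v_extreme by (auto simp: extreme_point_of_def)

lemma frontier_X: "x \<in> frontier P \<Longrightarrow> \<exists>k\<in>{1..n}. x \<in> sector k \<and> X k x = 1"
proof -
  assume "x \<in> frontier P"
  then obtain k where k: "k \<in> {1..n}" "x \<in> closed_segment (v k) (v (k + 1))"
    using frontier_edge by blast
  moreover from this obtain u where "0 \<le> u" "u \<le> 1" "x = (1 - u) *\<^sub>R v k + u *\<^sub>R v (k + 1)"
    unfolding in_segment by blast
  ultimately show ?thesis using XY_comb[OF k(1)] by (intro bexI[of _ k]) (auto simp: sector_def)
qed

text \<open>The ray from the origin through \<open>p\<close> leaves \<open>P\<close> at a point
  \<open>d *\<^sub>R p\<close> of some edge \<open>k\<close>, where \<open>d * X k p = 1\<close>.
  This places \<open>p\<close> in sector \<open>k\<close>, and \<open>X k p < 1\<close> means that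
  the exit comes after \<open>p\<close>.\<close>

lemma ray_frontier:
  assumes "p \<noteq> 0"
  shows "\<exists>k\<in>{1..n}. p \<in> sector k \<and> (X k p < 1 \<longrightarrow> p \<in> P)"
proof -
  obtain d where d: "0 < d" "d *\<^sub>R p \<in> frontier P" "\<And>e. 0 \<le> e \<Longrightarrow> e < d \<Longrightarrow> e *\<^sub>R p \<in> P"
    using ray_to_frontier[OF P_props(2), of 0 p] assms zero_in interior_P by auto
  obtain k where k: "k \<in> {1..n}" "d *\<^sub>R p \<in> sector k" "X k (d *\<^sub>R p) = 1"
    using frontier_X[OF d(2)] by blast
  have "\<bar>d * Y k p\<bar> \<le> d * X k p" and dX: "d * X k p = 1"
    using k XY_add_scale(3,4)[OF k(1)] by (auto simp: sector_def)
  then have "d * \<bar>Y k p\<bar> \<le> d * X k p" using d(1) by (simp add: abs_mult)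
  then have sec: "p \<in> sector k"
    using d(1) by (simp only: sector_def mem_Collect_eq mult_le_cancel_left_pos)
  have "p \<in> P" if "X k p < 1"
  proof -
    have "d * X k p < d * 1" using that d(1) by (rule mult_strict_left_mono)
    then show ?thesis using dX d(3)[of 1] by simp
  qed
  then show ?thesis using sec k(1) by blast
qed

lemma sectors_cover: "\<exists>k\<in>{1..n}. p \<in> sector k"
proof (cases "p = 0")
  case True
  have "1 \<in> {1..n}" using P_props(4) by simp
  moreover from this have "p \<in> sector 1" using True XY_add_scale(5,6)[of 1] by (simp add: sector_def)
  ultimately show ?thesis by blast
next
  case False
  then show ?thesis using ray_frontier by blast
qed

lemma P_iff: "p \<in> P \<longleftrightarrow> (\<forall>k\<in>{1..n}. X k p < 1)"
proof
  assume "\<forall>k\<in>{1..n}. X k p < 1"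
  then show "p \<in> P" using ray_frontier[of p] zero_in by (cases "p = 0") auto
qed (use X_less_1 in blast)

lemma X_sector_comb:
  assumes "k \<in> {1..n}" "j \<in> {1..n}"
  shows "X j p = (X k p - Y k p) / 2 * X j (v k) + (X k p + Y k p) / 2 * X j (v (k + 1))"
  by (rule trans[OF arg_cong[OF decomp[OF assms(1)], where f="X j"] XY_add_scale(1)[OF assms(2)]])

text \<open>\<open>X j\<close> is at most 1 at both vertices spanning the sector, and the
  coefficients of \<open>p\<close> are nonnegative there. Hence on sector \<open>k\<close> the
  function \<open>X k\<close> is the maximum of all \<open>X j\<close>, that is, the gauge of
  \<open>P\<close>.\<close>

lemma X_le_X_sector:
  assumes "k \<in> {1..n}" "j \<in> {1..n}" "p \<in> sector k"
  shows "X j p \<le> X k p"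
proof -
  have "X j p \<le> (X k p - Y k p) / 2 * 1 + (X k p + Y k p) / 2 * 1"
    unfolding X_sector_comb[OF assms(1,2), of p] using assms X_v_le_1
    by (intro add_mono mult_left_mono) (auto simp: sector_def)
  then show ?thesis by (simp add: field_simps)
qed

lemma sector_in_P_iff:
  assumes "k \<in> {1..n}" "p \<in> sector k"
  shows "p \<in> P \<longleftrightarrow> X k p < 1"
proof
  assume "X k p < 1"
  then have "\<forall>j\<in>{1..n}. X j p < 1"
    using X_le_X_sector[OF assms(1) _ assms(2)] order_le_less_trans by blast
  then show "p \<in> P" by (simp only: P_iff)
qed (rule X_less_1[OF assms(1)])

text \<open>Of three distinct points on a line one lies between the other two and cannot be extreme.
  The coordinate \<open>Y k\<close> orders the points on the line of edge \<open>k\<close>.\<close>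

lemma extreme_on_edge_line:
  assumes k: "k \<in> {1..n}" and w: "w extreme_point_of closure P" "X k w = 1"
  shows "w \<in> {v k, v (k + 1)}"
proof -
  have line: "z = (1 - (1 + Y k z) / 2) *\<^sub>R v k + ((1 + Y k z) / 2) *\<^sub>R v (k + 1)" if "X k z = 1" for z
    using that by (intro decompI[OF k]) (simp_all add: field_simps)
  have between: False if "a extreme_point_of closure P" "b extreme_point_of closure P" "c extreme_point_of closure P"
      "X k a = 1" "X k b = 1" "X k c = 1" "Y k a < Y k b" "Y k b < Y k c" for a b c
  proof -
    define u where "u = (Y k b - Y k a) / (Y k c - Y k a)"
    have u: "0 < u" "u < 1" "u * (Y k c - Y k a) = Y k b - Y k a" using that by (auto simp: u_def)
    have "Y k ((1 - u) *\<^sub>R a + u *\<^sub>R c) = Y k b" "X k ((1 - u) *\<^sub>R a + u *\<^sub>R c) = X k b"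
      unfolding XY_add_scale[OF k] using u(3) that by (simp_all add: algebra_simps)
    then have "b = (1 - u) *\<^sub>R a + u *\<^sub>R c" using decomp[OF k] by metis
    moreover have "a \<noteq> c" using that by auto
    ultimately have "b \<in> open_segment a c" using u by (auto simp: in_segment)
    then show False using that by (auto simp: extreme_point_of_def)
  qed
  note e = v_extreme[OF k] XY_v[OF k]
  consider "Y k w < -1" | "Y k w = -1" | "-1 < Y k w" "Y k w < 1" | "Y k w = 1" | "1 < Y k w" by linarith
  then have "Y k w = -1 \<or> Y k w = 1"
  proof cases
    case 1 then show ?thesis using between[of w "v k" "v (k + 1)"] e w by simp
  next
    case 3 then show ?thesis using between[of "v k" w "v (k + 1)"] e w by simp
  next
    case 5 then show ?thesis using between[of "v k" "v (k + 1)" w] e w by simp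
  qed simp_all
  then show ?thesis using line[OF w(2)] by auto
qed

text \<open>On the overlap \<open>X j\<close> and \<open>X k\<close> agree, so \<open>p\<close> can
  be rescaled to a point \<open>w\<close> on both edges. If \<open>w\<close> were interior to edge
  \<open>j\<close>, then \<open>X k\<close>, being at most 1 at both ends of that edge and equal to
  1 at \<open>w\<close>, would be 1 at both ends. The edges \<open>j\<close> and \<open>k\<close>
  would share both ends, each following the other, which is impossible for
  \<open>n \<ge> 3\<close>.\<close>

lemma sector_overlap:
  assumes jk: "j \<in> {1..n}" "k \<in> {1..n}" "j \<noteq> k" and p: "p \<in> sector j" "p \<in> sector k" "p \<noteq> 0"
  obtains w where "w \<in> {v j, v (j + 1)}" "w \<in> {v k, v (k + 1)}" "p = X j p *\<^sub>R w"
proof -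
  have eq: "X j p = X k p" using X_le_X_sector jk p by (intro antisym) auto
  have pos: "0 < X j p"
  proof (rule ccontr)
    assume "\<not> 0 < X j p"
    then have "X j p = 0" "Y j p = 0" using p(1) by (auto simp: sector_def)
    then have "p = 0 *\<^sub>R v j + 0 *\<^sub>R v (j + 1)" by (intro decompI[OF jk(1)]) simp_all
    then show False using p(3) by simp
  qed
  define w where "w = (1 / X j p) *\<^sub>R p"
  have w: "X j w = 1" "X k w = 1" "p = X j p *\<^sub>R w" "w \<in> sector j"
    using pos eq p XY_add_scale(3,4) jk by (auto simp: w_def sector_def abs_mult)
  have wy: "w = ((1 - Y j w) / 2) *\<^sub>R v j + ((1 + Y j w) / 2) *\<^sub>R v (j + 1)"
    using w(1) by (intro decompI[OF jk(1)]) simp_all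
  have "\<bar>Y j w\<bar> \<le> 1" using w(1,4) by (simp add: sector_def)
  then consider "Y j w = -1" | "Y j w = 1" | "\<bar>Y j w\<bar> < 1" by linarith
  then have "w \<in> {v j, v (j + 1)}"
  proof cases
    case 3
    have "1 = (1 - Y j w) / 2 * X k (v j) + (1 + Y j w) / 2 * X k (v (j + 1))"
      using X_sector_comb[OF jk(1,2), of w] w by simp
    then have "(1 - Y j w) * (1 - X k (v j)) + (1 + Y j w) * (1 - X k (v (j + 1))) = 0"
      by (simp add: field_simps)
    moreover have "(1 - Y j w) * (1 - X k (v j)) \<ge> 0" "(1 + Y j w) * (1 - X k (v (j + 1))) \<ge> 0"
      using X_v_le_1 jk 3 by auto
    ultimately have "(1 - Y j w) * (1 - X k (v j)) = 0" "(1 + Y j w) * (1 - X k (v (j + 1))) = 0" by linarith+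
    then have "X k (v j) = 1" "X k (v (j + 1)) = 1" using 3 by auto
    then have "v j \<in> {v k, v (k + 1)}" "v (j + 1) \<in> {v k, v (k + 1)}"
      using extreme_on_edge_line[OF jk(2)] v_extreme jk by blast+
    then have "v j = v k \<or> v j = v (nxt k)" "v (nxt j) = v k \<or> v (nxt j) = v (nxt k)"
      by (simp_all only: nxt(2) insert_iff empty_iff simp_thms)
    moreover have "v (nxt j) \<noteq> v j" using v_neq[OF jk(1)] unfolding nxt(2) by (rule not_sym)
    ultimately have "j = nxt k \<and> nxt j = k"
      using nxt(1)[OF jk(1)] nxt(1)[OF jk(2)] jk by (auto simp only: v_eq_iff)
    then show ?thesis using jk P_props(4) by (auto simp: nxt_def split: if_splits)
  qed (use wy in auto)
  moreover from this have "w extreme_point_of closure P" using v_extreme jk by blast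
  then have "w \<in> {v k, v (k + 1)}" using extreme_on_edge_line[OF jk(2)] w by blast
  ultimately show thesis using that w by blast
qed

text \<open>The witnesses are the edges before and after edge \<open>k\<close>. As
  \<open>n \<ge> 3\<close>, each of them shares just one vertex with edge \<open>k\<close>. They
  will control \<open>Y k\<close> near the two ends of this edge.\<close>

lemma adjacent_edges:
  assumes k: "k \<in> {1..n}"
  shows "\<exists>j\<in>{1..n}. X j (v k) = 1 \<and> X j (v (k + 1)) < 1"
    and "\<exists>j\<in>{1..n}. X j (v (k + 1)) = 1 \<and> X j (v k) < 1"
proof -
  have ne: "X j z \<noteq> 1" if "j \<in> {1..n}" "z extreme_point_of closure P" "z \<noteq> v j" "z \<noteq> v (j + 1)" for j z
    using extreme_on_edge_line[of j z] that by blast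
  define j where "j = (if k = 1 then n else k - 1)"
  have j: "j \<in> {1..n}" "nxt j = k" using k P_props(4) by (auto simp: j_def nxt_def)
  have "nxt k \<noteq> j" "nxt k \<noteq> k" using k P_props(4) by (auto simp: j_def nxt_def)
  then have "v (k + 1) \<noteq> v j" "v (k + 1) \<noteq> v (j + 1)"
    using nxt(1)[OF k] j k by (simp_all only: nxt(2) v_eq_iff not_False_eq_True)
  then have "X j (v (k + 1)) \<noteq> 1" using ne[OF j(1)] v_extreme[OF k] by blast
  moreover have "X j (v (k + 1)) \<le> 1" using X_v_le_1 j k by blast
  moreover have "X j (v k) = 1" using XY_v(3)[OF j(1)] nxt(2)[of j] j by simp
  ultimately show "\<exists>j\<in>{1..n}. X j (v k) = 1 \<and> X j (v (k + 1)) < 1" using j by force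
  define i where "i = nxt k"
  have i: "i \<in> {1..n}" "v (k + 1) = v i" using nxt k by (auto simp: i_def)
  have "k \<noteq> i" "k \<noteq> nxt i" using k P_props(4) by (auto simp: i_def nxt_def)
  then have "v k \<noteq> v i" "v k \<noteq> v (i + 1)"
    using nxt(1)[OF i(1)] i(1) k by (simp_all only: nxt(2) v_eq_iff not_False_eq_True)
  then have "X i (v k) \<noteq> 1" using ne[OF i(1)] v_extreme[OF k] by blast
  moreover have "X i (v k) \<le> 1" using X_v_le_1 i k by blast
  moreover have "X i (v (k + 1)) = 1" using XY_v(1)[OF i(1)] i by simp
  ultimately show "\<exists>j\<in>{1..n}. X j (v (k + 1)) = 1 \<and> X j (v k) < 1" using i by force
qed

end

section \<open>The polygon map is a homeomorphism\<close>

context polygon_around_origin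
begin

text \<open>This is \<open>\<alpha>\<close> applied to both coordinates of \<open>L_map v k\<close>
  and carried back by its inverse. The choice \<open>artanh\<close> gives the local formula of
  \<open>f\<close>, and \<open>tanh\<close> that of the inverse map, so both share the lemmas
  below.\<close>

definition chart :: "(real \<Rightarrow> real) \<Rightarrow> nat \<Rightarrow> real \<times> real \<Rightarrow> real \<times> real" where
  "chart \<alpha> k p = ((\<alpha> (X k p) - \<alpha> (Y k p)) / 2) *\<^sub>R v k + ((\<alpha> (X k p) + \<alpha> (Y k p)) / 2) *\<^sub>R v (k + 1)"

lemma XY_chart:
  assumes "k \<in> {1..n}"
  shows "X k (chart \<alpha> k p) = \<alpha> (X k p)" "Y k (chart \<alpha> k p) = \<alpha> (Y k p)"
  unfolding chart_def XY_comb[OF assms] by (simp_all add: field_simps)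

lemma XY_eqI:
  assumes "k \<in> {1..n}" "X k p = X k q" "Y k p = Y k q"
  shows "p = q"
  using decomp[OF assms(1), of p] decomp[OF assms(1), of q] unfolding assms(2,3) by (rule trans_sym)

lemma inv_L_map:
  assumes "k \<in> {1..n}"
  shows "inv (L_map v k) (\<alpha> (X k p), \<alpha> (Y k p)) = chart \<alpha> k p"
proof (rule inv_f_eq)
  show "inj (L_map v k)" by (rule injI, rule XY_eqI[OF assms]) simp_all
  show "L_map v k (chart \<alpha> k p) = (\<alpha> (X k p), \<alpha> (Y k p))"
    using XY_chart[OF assms] by (intro prod_eqI) simp_all
qed

text \<open>On the ray through \<open>w\<close> the second coordinate equals the first up to sign,
  and oddness lets \<open>\<alpha>\<close> respect that sign. Oddness is asked at the single value
  \<open>r\<close>, so that \<open>artanh\<close> can be used at arguments inside (-1, 1).\<close>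

lemma chart_ray:
  assumes k: "k \<in> {1..n}" and w: "w \<in> {v k, v (k + 1)}" and odd: "\<alpha> (- r) = - \<alpha> r"
  shows "chart \<alpha> k (r *\<^sub>R w) = \<alpha> r *\<^sub>R w"
proof (rule XY_eqI[OF k])
  have "X k w = 1" "Y k w = 1 \<or> Y k w = -1" using w XY_v[OF k] by auto
  then show "X k (chart \<alpha> k (r *\<^sub>R w)) = X k (\<alpha> r *\<^sub>R w)" "Y k (chart \<alpha> k (r *\<^sub>R w)) = Y k (\<alpha> r *\<^sub>R w)"
    unfolding XY_chart[OF k] XY_add_scale(3,4)[OF k] using odd by auto
qed

lemma chart_agree:
  assumes "j \<in> {1..n}" "k \<in> {1..n}" "p \<in> sector j" "p \<in> sector k" "\<alpha> (- X j p) = - \<alpha> (X j p)"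
  shows "chart \<alpha> j p = chart \<alpha> k p"
proof -
  consider "j = k" | "p = 0" | "j \<noteq> k" "p \<noteq> 0" by blast
  then show ?thesis
  proof cases
    case 2
    then show ?thesis using assms(5) XY_add_scale(5,6) assms(1,2) by (simp add: chart_def)
  next
    case 3
    obtain w where w: "w \<in> {v j, v (j + 1)}" "w \<in> {v k, v (k + 1)}" "p = X j p *\<^sub>R w"
      using sector_overlap[OF assms(1,2) 3(1) assms(3,4) 3(2)] .
    have "chart \<alpha> j (X j p *\<^sub>R w) = chart \<alpha> k (X j p *\<^sub>R w)"
      unfolding chart_ray[OF assms(1) w(1) assms(5)] chart_ray[OF assms(2) w(2) assms(5)] ..
    then show ?thesis by (simp only: w(3)[symmetric])
  qed simp
qed

lemma in_triangle_iff:
  assumes k: "k \<in> {1..n}"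
  shows "p \<in> triangle v k \<longleftrightarrow> p \<in> P \<and> p \<in> sector k"
proof -
  have "p \<in> triangle v k \<longleftrightarrow> p \<in> sector k \<and> X k p < 1"
  proof
    assume "p \<in> triangle v k"
    then obtain s t where "p = s *\<^sub>R v k + t *\<^sub>R v (k + 1)" "0 \<le> s" "0 \<le> t" "s + t < 1"
      unfolding triangle_def by blast
    then show "p \<in> sector k \<and> X k p < 1" using XY_comb[OF k] by (auto simp: sector_def)
  next
    assume "p \<in> sector k \<and> X k p < 1"
    then have "\<bar>Y k p\<bar> \<le> X k p" "X k p < 1" by (simp_all add: sector_def)
    then have "0 \<le> (X k p - Y k p) / 2" "0 \<le> (X k p + Y k p) / 2" by simp_all
    moreover have "(X k p - Y k p) / 2 + (X k p + Y k p) / 2 < 1" using \<open>X k p < 1\<close> by argo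
    ultimately show "p \<in> triangle v k"
      unfolding triangle_def mem_Collect_eq by (intro exI conjI) (rule decomp[OF k])
  qed
  then show ?thesis using sector_in_P_iff[OF k] by blast
qed

lemma P_XY_bound:
  assumes "k \<in> {1..n}" "p \<in> P" "p \<in> sector k"
  shows "\<bar>X k p\<bar> < 1" "\<bar>Y k p\<bar> < 1" "\<bar>Y k p\<bar> \<le> X k p"
  using X_less_1[OF assms(1,2)] assms(3) by (auto simp: sector_def)

lemma polygon_map_eq:
  assumes k: "k \<in> {1..n}" and p: "p \<in> P" "p \<in> sector k"
  shows "polygon_map n v p = chart artanh k p"
proof -
  have Phi: "inv (L_map v j) (Phi (L_map v j p)) = chart artanh j p" if "j \<in> {1..n}" for j
    using inv_L_map[OF that, of artanh p] by (simp add: Phi_def case_prod_beta)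
  show ?thesis unfolding polygon_map_def
  proof (rule the_equality)
    show "\<exists>j\<in>{1..n}. p \<in> triangle v j \<and> chart artanh k p = inv (L_map v j) (Phi (L_map v j p))"
      using k p in_triangle_iff Phi by metis
    fix q assume "\<exists>j\<in>{1..n}. p \<in> triangle v j \<and> q = inv (L_map v j) (Phi (L_map v j p))"
    then obtain j where j: "j \<in> {1..n}" "p \<in> sector j" "q = chart artanh j p"
      using in_triangle_iff Phi by metis
    show "q = chart artanh k p"
      unfolding j(3) using P_XY_bound(1)[OF j(1) p(1) j(2)]
      by (intro chart_agree j k p) simp
  qed
qed

definition polygon_unmap :: "real \<times> real \<Rightarrow> real \<times> real" where
  "polygon_unmap q = chart tanh (SOME k. k \<in> {1..n} \<and> q \<in> sector k) q"

lemma polygon_unmap_eq: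
  assumes "k \<in> {1..n}" "q \<in> sector k"
  shows "polygon_unmap q = chart tanh k q"
proof -
  have "(SOME k. k \<in> {1..n} \<and> q \<in> sector k) \<in> {1..n} \<and> q \<in> sector (SOME k. k \<in> {1..n} \<and> q \<in> sector k)"
    by (rule someI[of _ k]) (use assms in blast)
  then show ?thesis unfolding polygon_unmap_def using assms by (intro chart_agree) simp_all
qed

lemma chart_tanh_in:
  assumes "k \<in> {1..n}" "q \<in> sector k"
  shows "chart tanh k q \<in> sector k" "chart tanh k q \<in> P"
proof -
  show *: "chart tanh k q \<in> sector k"
    using assms(2) unfolding sector_def mem_Collect_eq XY_chart[OF assms(1)] tanh_real_abs[symmetric] tanh_real_le_iff .
  show "chart tanh k q \<in> P"
    unfolding sector_in_P_iff[OF assms(1) *] XY_chart[OF assms(1)] by (rule tanh_real_lt_1)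
qed

lemma chart_artanh_in:
  assumes "k \<in> {1..n}" "p \<in> P" "p \<in> sector k"
  shows "chart artanh k p \<in> sector k"
proof -
  note b = P_XY_bound[OF assms]
  have "artanh (Y k p) \<le> artanh (X k p)" "artanh (- Y k p) \<le> artanh (X k p)"
    by (rule artanh_le_iff[THEN iffD2]; use b in simp)+
  then show ?thesis
    using b unfolding sector_def mem_Collect_eq XY_chart[OF assms(1)] by simp
qed

lemma polygon_unmap_map:
  assumes "p \<in> P"
  shows "polygon_unmap (polygon_map n v p) = p"
proof -
  obtain k where k: "k \<in> {1..n}" "p \<in> sector k" using sectors_cover by blast
  note b = P_XY_bound[OF k(1) assms k(2)]
  have "chart tanh k (chart artanh k p) = p"
    by (rule XY_eqI[OF k(1)]) (use b in \<open>simp_all add: XY_chart[OF k(1)] tanh_artanh\<close>)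
  then show ?thesis
    using polygon_map_eq[OF k(1) assms k(2)] polygon_unmap_eq[OF k(1) chart_artanh_in[OF k(1) assms k(2)]]
    by simp
qed

lemma polygon_unmap_in: "polygon_unmap q \<in> P"
  and polygon_map_unmap: "polygon_map n v (polygon_unmap q) = q"
proof -
  obtain k where k: "k \<in> {1..n}" "q \<in> sector k" using sectors_cover by blast
  note c = chart_tanh_in[OF k]
  show "polygon_unmap q \<in> P" using polygon_unmap_eq[OF k] c by simp
  have "chart artanh k (chart tanh k q) = q"
    by (rule XY_eqI[OF k(1)]) (simp_all add: XY_chart[OF k(1)] artanh_tanh_real)
  then show "polygon_map n v (polygon_unmap q) = q"
    using polygon_map_eq[OF k(1) c(2,1)] polygon_unmap_eq[OF k] by simp
qed

lemma continuous_X: "k \<in> {1..n} \<Longrightarrow> continuous_on S (X k)"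
  and continuous_Y: "k \<in> {1..n} \<Longrightarrow> continuous_on S (Y k)"
  using X_linear Y_linear by (simp_all add: linear_continuous_on linear_conv_bounded_linear[symmetric])

lemma closed_sector:
  assumes "k \<in> {1..n}"
  shows "closed (sector k)"
  unfolding sector_def
  by (intro closed_Collect_le continuous_on_rabs continuous_X[OF assms] continuous_Y[OF assms])

lemma continuous_polygon_unmap: "continuous_on UNIV polygon_unmap"
proof -
  have "continuous_on (\<Union>k\<in>{1..n}. sector k) polygon_unmap"
  proof (rule continuous_on_closed_Union)
    fix k assume k: "k \<in> {1..n}"
    have tanh: "continuous_on A (\<lambda>p. tanh (g p))" if "continuous_on A g" for A and g :: "real \<times> real \<Rightarrow> real"
      using that by (intro continuous_on_tanh) auto
    have "continuous_on (sector k) (chart tanh k)"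
      unfolding chart_def by (intro continuous_intros tanh continuous_X[OF k] continuous_Y[OF k]) simp_all
    then show "continuous_on (sector k) polygon_unmap"
      using polygon_unmap_eq[OF k] by (simp cong: continuous_on_cong)
  qed (simp_all add: closed_sector)
  moreover have "(\<Union>k\<in>{1..n}. sector k) = UNIV" using sectors_cover by blast
  ultimately show ?thesis by simp
qed

lemma polygon_homeomorphism: "homeomorphism P UNIV (polygon_map n v) polygon_unmap"
proof -
  have inj: "inj polygon_unmap" using polygon_map_unmap by (rule inj_on_inverseI)
  have img: "range polygon_unmap = P"
  proof
    show "P \<subseteq> range polygon_unmap"
      using polygon_unmap_map by (intro subsetI) (rule range_eqI, rule sym)
  qed (use polygon_unmap_in in blast)
  obtain g where g: "homeomorphism UNIV P polygon_unmap g"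
    using invariance_of_domain_homeomorphism[OF open_UNIV continuous_polygon_unmap _ inj] img by auto
  have "g p = polygon_map n v p" if "p \<in> P" for p
  proof -
    have "g (polygon_unmap (polygon_map n v p)) = polygon_map n v p"
      using g unfolding homeomorphism_def by blast
    then show ?thesis by (simp only: polygon_unmap_map[OF that])
  qed
  then show ?thesis
    using g by (intro homeomorphism_cong[OF homeomorphism_sym[THEN iffD1, OF g]]) auto
qed

section \<open>Open sectors, vertex rays and smoothness\<close>

definition open_sector :: "nat \<Rightarrow> (real \<times> real) set" where
  "open_sector k = {p. \<bar>Y k p\<bar> < X k p}"

lemma open_open_sector:
  assumes "k \<in> {1..n}"
  shows "open (open_sector k)"
  unfolding open_sector_def
  by (intro open_Collect_less continuous_on_rabs continuous_X[OF assms] continuous_Y[OF assms])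

lemma open_sector_subset: "open_sector k \<subseteq> sector k"
  by (auto simp: open_sector_def sector_def)

text \<open>The boundary rays of a sector pass through its own two vertices. Conversely, a nonzero
  point on the ray of another vertex \<open>v i\<close> also lies in sector \<open>i\<close>, and
  two sectors meet only in rays through common vertices.\<close>

lemma on_vertex_ray_iff:
  assumes k: "k \<in> {1..n}" and p: "p \<in> sector k"
  shows "(\<exists>i\<in>{1..n}. \<exists>s\<ge>0. p = s *\<^sub>R v i) \<longleftrightarrow> p \<notin> open_sector k"
proof
  assume "\<exists>i\<in>{1..n}. \<exists>s\<ge>0. p = s *\<^sub>R v i"
  then obtain i s where i: "i \<in> {1..n}" "0 \<le> s" "p = s *\<^sub>R v i" by blast
  have "\<bar>Y k p\<bar> = X k p"
  proof (cases "p = 0")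
    case True
    then show ?thesis using XY_add_scale(5,6)[OF k] by simp
  next
    case False
    then have s: "0 < s" using i by (cases "s = 0") auto
    have Xi: "X i p = s" "Y i p = - s" unfolding i(3) XY_add_scale(3,4)[OF i(1)] XY_v[OF i(1)] by simp_all
    have "\<exists>w\<in>{v k, v (k + 1)}. p = s *\<^sub>R w"
    proof (cases "i = k")
      case False
      have "p \<in> sector i" using Xi s by (simp add: sector_def)
      obtain w where "w \<in> {v i, v (i + 1)}" and w: "w \<in> {v k, v (k + 1)}" and pw: "p = X i p *\<^sub>R w"
        using sector_overlap[OF i(1) k False \<open>p \<in> sector i\<close> p \<open>p \<noteq> 0\<close>] .
      have "p = s *\<^sub>R w" using pw Xi(1) by (simp only:)
      then show ?thesis using w by (intro bexI)
    qed (use i in blast)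
    then obtain w where w: "w \<in> {v k, v (k + 1)}" "p = s *\<^sub>R w" by blast
    have "X k w = 1" "Y k w = 1 \<or> Y k w = -1" using w(1) XY_v[OF k] by auto
    then show ?thesis unfolding w(2) XY_add_scale(3,4)[OF k] using s by auto
  qed
  then show "p \<notin> open_sector k" by (simp add: open_sector_def)
next
  assume "p \<notin> open_sector k"
  then have "\<bar>Y k p\<bar> = X k p" using p by (auto simp: sector_def open_sector_def)
  then consider "X k p - Y k p = 0" "0 \<le> X k p" | "X k p + Y k p = 0" "0 \<le> X k p" by linarith
  then show "\<exists>i\<in>{1..n}. \<exists>s\<ge>0. p = s *\<^sub>R v i"
  proof cases
    case 1
    have "p = 0 *\<^sub>R v k + X k p *\<^sub>R v (k + 1)" by (rule decompI[OF k]) (use 1 in simp_all)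
    then have "p = X k p *\<^sub>R v (nxt k)" unfolding nxt(2) by simp
    then show ?thesis using 1 nxt(1)[OF k] by (intro bexI exI conjI)
  next
    case 2
    have "p = X k p *\<^sub>R v k + 0 *\<^sub>R v (k + 1)" by (rule decompI[OF k]) (use 2 in simp_all)
    then have "p = X k p *\<^sub>R v k" by simp
    then show ?thesis using 2 k by (intro bexI exI conjI)
  qed
qed

lemma vertex_ray_iff_not_open_sector:
  "(\<exists>i\<in>{1..n}. \<exists>s\<ge>0. p = s *\<^sub>R v i) \<longleftrightarrow> (\<forall>k\<in>{1..n}. p \<notin> open_sector k)" (is "?ray \<longleftrightarrow> _")
proof
  assume ray: ?ray
  show "\<forall>k\<in>{1..n}. p \<notin> open_sector k"
  proof (intro ballI notI)
    fix k assume k: "k \<in> {1..n}" "p \<in> open_sector k"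
    then have "p \<in> sector k" using open_sector_subset by blast
    from on_vertex_ray_iff[OF k(1) this] ray have "p \<notin> open_sector k" by (rule iffD1)
    then show False using k(2) by contradiction
  qed
next
  assume *: "\<forall>k\<in>{1..n}. p \<notin> open_sector k"
  obtain k where k: "k \<in> {1..n}" "p \<in> sector k" using sectors_cover by blast
  have "p \<notin> open_sector k" using * k(1) by (rule bspec)
  then show ?ray by (rule iffD2[OF on_vertex_ray_iff[OF k]])
qed

lemma complement_vertex_rays:
  "UNIV - (\<Union>k\<in>{1..n}. {s *\<^sub>R v k | s. 0 \<le> s}) = (\<Union>k\<in>{1..n}. open_sector k)"
proof (intro set_eqI)
  fix p
  have "p \<in> UNIV - (\<Union>k\<in>{1..n}. {s *\<^sub>R v k | s. 0 \<le> s}) \<longleftrightarrow> \<not> (\<exists>i\<in>{1..n}. \<exists>s\<ge>0. p = s *\<^sub>R v i)"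
    by auto
  also have "\<dots> \<longleftrightarrow> p \<in> (\<Union>k\<in>{1..n}. open_sector k)"
    unfolding vertex_ray_iff_not_open_sector by blast
  finally show "p \<in> UNIV - (\<Union>k\<in>{1..n}. {s *\<^sub>R v k | s. 0 \<le> s}) \<longleftrightarrow> p \<in> (\<Union>k\<in>{1..n}. open_sector k)" .
qed

lemma vertex_segment_iff:
  assumes "p \<in> P"
  shows "p \<in> (\<Union>k\<in>{1..n}. {s *\<^sub>R v k | s. 0 \<le> s \<and> s < 1}) \<longleftrightarrow> (\<exists>i\<in>{1..n}. \<exists>s\<ge>0. p = s *\<^sub>R v i)"
    (is "?l \<longleftrightarrow> ?r")
proof
  assume ?l
  then obtain i s where "i \<in> {1..n}" "p = s *\<^sub>R v i" "0 \<le> s" by (elim UN_E CollectE exE conjE)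
  then show ?r by (intro bexI exI conjI)
next
  assume ?r
  then obtain i s where i: "i \<in> {1..n}" "0 \<le> s" "p = s *\<^sub>R v i" by (elim bexE exE conjE)
  have "X i (s *\<^sub>R v i) < 1" using X_less_1[OF i(1) assms] unfolding i(3) .
  then have "s < 1" unfolding XY_add_scale(3)[OF i(1)] XY_v(1)[OF i(1)] by simp
  then have "p \<in> {s *\<^sub>R v i | s. 0 \<le> s \<and> s < 1}" using i(2,3) by (intro CollectI exI[of _ s] conjI)
  with i(1) show ?l by (rule UN_I)
qed

lemma polygon_complement_vertex_segments:
  "P - (\<Union>k\<in>{1..n}. {s *\<^sub>R v k | s. 0 \<le> s \<and> s < 1}) = (\<Union>k\<in>{1..n}. open_sector k \<inter> P)"
proof -
  define A where "A = (\<Union>k\<in>{1..n}. {s *\<^sub>R v k | s. 0 \<le> s \<and> s < 1})"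
  have "p \<in> A \<longleftrightarrow> (\<forall>k\<in>{1..n}. p \<notin> open_sector k)" if "p \<in> P" for p
    unfolding A_def vertex_segment_iff[OF that] by (rule vertex_ray_iff_not_open_sector)
  then have "P - A = (\<Union>k\<in>{1..n}. open_sector k \<inter> P)" by blast
  then show ?thesis unfolding A_def .
qed

text \<open>Regrouped by \<open>X k\<close> and \<open>Y k\<close> instead of by vertices, the chart
  is a sum of two ridge functions whose directions are half the sum and half the difference of the
  two vertices.\<close>

lemma smooth_chart:
  assumes k: "k \<in> {1..n}" and "open S" "X k ` S \<subseteq> I" "Y k ` S \<subseteq> I"
    and g: "g 0 = \<alpha>" "\<And>i x. x \<in> I \<Longrightarrow> (g i has_real_derivative g (Suc i) x) (at x)"
  shows "Ck_on m S (chart \<alpha> k)"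
proof -
  have eq: "a *\<^sub>R ((1/2) *\<^sub>R (u + w)) + b *\<^sub>R ((1/2) *\<^sub>R (w - u)) = ((a - b) / 2) *\<^sub>R u + ((a + b) / 2) *\<^sub>R w"
    for a b and u w :: "real \<times> real"
    by (simp add: prod_eq_iff field_simps)
  have "Ck_on m S (\<lambda>p. g 0 (X k p) *\<^sub>R ((1/2) *\<^sub>R (v k + v (k + 1))) + g 0 (Y k p) *\<^sub>R ((1/2) *\<^sub>R (v (k + 1) - v k)))"
    by (intro Ck_on_add[OF assms(2)] Ck_on_ridge[of S "X k" I g, OF assms(2) X_linear[OF k] assms(3) g(2)]
          Ck_on_ridge[of S "Y k" I g, OF assms(2) Y_linear[OF k] assms(4) g(2)])
  then show ?thesis unfolding eq g(1) chart_def[abs_def] .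
qed

lemma polygon_smooth_diffeomorphism:
  defines "U \<equiv> \<Union>k\<in>{1..n}. open_sector k \<inter> P" and "V \<equiv> \<Union>k\<in>{1..n}. open_sector k"
  shows "polygon_map n v ` U = V" "smooth_diffeomorphism U V (polygon_map n v)"
proof -
  let ?f = "polygon_map n v"
  have U1: "?f p = chart artanh k p" "chart artanh k p \<in> open_sector k"
    if k: "k \<in> {1..n}" and p: "p \<in> open_sector k \<inter> P" for k p
  proof -
    have s: "p \<in> sector k" "p \<in> P" using p open_sector_subset by auto
    show "?f p = chart artanh k p" by (rule polygon_map_eq[OF k s(2,1)])
    have "artanh (Y k p) < artanh (X k p)" "artanh (- Y k p) < artanh (X k p)"
      by (rule artanh_less_iff[THEN iffD2]; use P_XY_bound(1,2)[OF k s(2,1)] p in \<open>simp add: open_sector_def abs_less_iff\<close>)+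
    then show "chart artanh k p \<in> open_sector k"
      using P_XY_bound(2)[OF k s(2,1)] unfolding open_sector_def mem_Collect_eq XY_chart[OF k] by simp
  qed
  have V1: "polygon_unmap q = chart tanh k q" "chart tanh k q \<in> open_sector k \<inter> P"
    if k: "k \<in> {1..n}" and q: "q \<in> open_sector k" for k q
  proof -
    have s: "q \<in> sector k" using q open_sector_subset by auto
    show "polygon_unmap q = chart tanh k q" by (rule polygon_unmap_eq[OF k s])
    have "chart tanh k q \<in> open_sector k"
      using q unfolding open_sector_def mem_Collect_eq XY_chart[OF k] tanh_real_abs[symmetric] tanh_real_less_iff .
    then show "chart tanh k q \<in> open_sector k \<inter> P" using chart_tanh_in(2)[OF k s] by blast
  qed
  show img: "?f ` U = V"
  proof
    show "?f ` U \<subseteq> V"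
    proof
      fix q assume "q \<in> ?f ` U"
      then obtain k p where kp: "k \<in> {1..n}" "p \<in> open_sector k \<inter> P" "q = ?f p" unfolding U_def by blast
      have "q \<in> open_sector k" using U1[OF kp(1,2)] kp(3) by simp
      then show "q \<in> V" using kp(1) unfolding V_def by blast
    qed
    show "V \<subseteq> ?f ` U"
    proof
      fix q assume "q \<in> V"
      then obtain k where k: "k \<in> {1..n}" "q \<in> open_sector k" unfolding V_def by blast
      have "polygon_unmap q \<in> open_sector k \<inter> P" using V1[OF k] by simp
      then have "polygon_unmap q \<in> U" using k(1) unfolding U_def by blast
      then show "q \<in> ?f ` U" by (intro image_eqI[where x = "polygon_unmap q"]) (simp_all add: polygon_map_unmap)
    qed
  qed
  have UP: "U \<subseteq> P" unfolding U_def by blast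
  have inj: "inj_on ?f U"
    by (rule inj_on_inverseI[of _ polygon_unmap]) (rule polygon_unmap_map[OF subsetD[OF UP]])
  have inv: "polygon_unmap q = inv_into U ?f q" if q: "q \<in> V" for q
  proof -
    obtain p where p: "p \<in> U" "q = ?f p" using q unfolding img[symmetric] by (rule imageE)
    show ?thesis unfolding p(2) polygon_unmap_map[OF subsetD[OF UP p(1)]] inv_into_f_f[OF inj p(1)] ..
  qed
  have openU: "open (open_sector k \<inter> P)" if "k \<in> {1..n}" for k
    using open_open_sector[OF that] P_props(1) by (rule open_Int)
  have "Ck_on m U ?f" for m
    unfolding U_def
  proof (rule Ck_on_UN)
    fix k assume k: "k \<in> {1..n}"
    obtain g where g0: "g 0 = artanh" and g: "\<forall>i. \<forall>x\<in>{-1<..<1}. (g i has_real_derivative g (Suc i) x) (at x)"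
      using artanh_iterated_derivatives by (elim exE conjE)
    have bound: "X k p \<in> {-1<..<1}" "Y k p \<in> {-1<..<1}" if p: "p \<in> open_sector k \<inter> P" for p
    proof -
      have "p \<in> P" "p \<in> sector k" using p open_sector_subset by blast+
      from P_XY_bound(1,2)[OF k this] show "X k p \<in> {-1<..<1}" "Y k p \<in> {-1<..<1}" by (auto simp: abs_less_iff)
    qed
    have sub: "X k ` (open_sector k \<inter> P) \<subseteq> {-1<..<1}" "Y k ` (open_sector k \<inter> P) \<subseteq> {-1<..<1}"
      by (intro image_subsetI bound; assumption)+
    have "Ck_on m (open_sector k \<inter> P) (chart artanh k)"
      by (rule smooth_chart[OF k openU[OF k] sub, where g = g]) (rule g0, use g in blast)
    then show "Ck_on m (open_sector k \<inter> P) ?f"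
      by (rule Ck_on_cong[OF openU[OF k], rotated]) (rule U1(1)[OF k, symmetric])
  qed (rule openU)
  moreover have "Ck_on m V (inv_into U ?f)" for m
  proof -
    have Ck: "Ck_on m V polygon_unmap"
      unfolding V_def
    proof (rule Ck_on_UN)
      fix k assume k: "k \<in> {1..n}"
      obtain g :: "nat \<Rightarrow> real \<Rightarrow> real"
        where g0: "g 0 = tanh" and g: "\<forall>i x. (g i has_real_derivative g (Suc i) x) (at x)"
        using tanh_iterated_derivatives by (elim exE conjE)
      from smooth_chart[OF k open_open_sector[OF k] subset_UNIV subset_UNIV g0 spec[OF spec[OF g]]]
      show "Ck_on m (open_sector k) polygon_unmap"
        by (rule Ck_on_cong[OF open_open_sector[OF k], rotated]) (rule V1(1)[OF k, symmetric])
    qed (rule open_open_sector)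
    have "open V" unfolding V_def by (intro open_UN ballI open_open_sector)
    then show ?thesis using inv Ck by (rule Ck_on_cong)
  qed
  moreover have "open U" "open V" unfolding U_def V_def by (intro open_UN ballI openU open_open_sector; assumption)+
  ultimately show "smooth_diffeomorphism U V ?f"
    using inj img by (simp add: smooth_diffeomorphism_def smooth_on_def bij_betw_def)
qed

end

section \<open>The polygon map is bi-Lipschitz\<close>

context polygon_around_origin
begin

text \<open>\<open>1 - X j\<close> is proportional to the distance from the line of edge
  \<open>j\<close>, so \<open>h j\<close> is the logarithm of that distance up to an additive
  constant.\<close>

definition h :: "nat \<Rightarrow> real \<times> real \<Rightarrow> real" where "h j p = ln (1 - X j p)"

text \<open>The curve \<open>\<gamma>\<close> runs along the chord by Hilbert arc length and will
  bound \<open>f\<close> from above. The two edges \<open>i\<close> and \<open>j\<close> recover the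
  Hilbert distance from increments of \<open>h\<close>, which is what the opposite inequality
  uses.\<close>

lemma hilbert_chord:
  assumes pq: "p \<in> P" "q \<in> P" "p \<noteq> q"
  obtains \<gamma> u u' i j where "continuous_on UNIV \<gamma>" "\<forall>x. \<gamma> x \<in> P" "\<gamma> u = p" "\<gamma> u' = q"
    "u < u'" "u' - u = hilbert_dist P p q"
    "\<forall>k\<in>{1..n}. \<forall>x y. \<bar>h k (\<gamma> x) - h k (\<gamma> y)\<bar> \<le> 2 * \<bar>x - y\<bar>"
    "i \<in> {1..n}" "j \<in> {1..n}" "2 * hilbert_dist P p q \<le> \<bar>h i p - h i q\<bar> + \<bar>h j p - h j q\<bar>"
proof -
  obtain a b s t where ab: "affine hull {p, q} \<inter> frontier P = {a, b}"
    and p: "p = (1 - s) *\<^sub>R a + s *\<^sub>R b" and q: "q = (1 - t) *\<^sub>R a + t *\<^sub>R b"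
    and st: "0 < s" "s < t" "t < 1"
    and chord: "\<forall>r\<in>{0<..<1}. (1 - r) *\<^sub>R a + r *\<^sub>R b \<in> P"
    using chord_exists[OF P_props(1-3) pq] .
  define \<sigma> where "\<sigma> u = (1 + tanh u) / 2" for u :: real
  define \<gamma> where "\<gamma> u = (1 - \<sigma> u) *\<^sub>R a + \<sigma> u *\<^sub>R b" for u
  have \<sigma>: "0 < \<sigma> u" "\<sigma> u < 1" for u using tanh_real_bounds[of u] by (auto simp: \<sigma>_def)
  have \<gamma>_in: "\<forall>x. \<gamma> x \<in> P" unfolding \<gamma>_def using chord \<sigma> by simp
  have \<sigma>_inv: "\<sigma> (artanh (2 * r - 1)) = r" if "0 < r" "r < 1" for r
    using that by (simp add: \<sigma>_def tanh_artanh abs_less_iff)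
  have art: "artanh (2 * r - 1) = (ln r - ln (1 - r)) / 2" if "0 < r" "r < 1" for r :: real
  proof -
    have "(1 + (2 * r - 1)) / (1 - (2 * r - 1)) = r / (1 - r)" using that by (simp add: field_simps)
    then show ?thesis using that by (simp add: artanh_def ln_div)
  qed
  define u u' where "u = artanh (2 * s - 1)" and "u' = artanh (2 * t - 1)"
  have hd: "hilbert_dist P p q = ((ln (1 - s) - ln s) + (ln t - ln (1 - t))) / 2"
    unfolding hilbert_dist_eqI[OF pq(3) ab p q st] using st by (simp add: ln_mult ln_div)
  have endpoints: "\<gamma> u = p" "\<gamma> u' = q"
    using st unfolding \<gamma>_def u_def u'_def by (simp_all add: \<sigma>_inv p q)
  have len: "u' - u = hilbert_dist P p q"
    using art[of s] art[of t] st unfolding hd u_def u'_def by simp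
  have "ln s < ln t" "ln (1 - t) < ln (1 - s)" using st by simp_all
  moreover have "u = (ln s - ln (1 - s)) / 2" "u' = (ln t - ln (1 - t)) / 2"
    using art[of s] art[of t] st unfolding u_def u'_def by simp_all
  ultimately have "u < u'" by argo
  have cont: "continuous_on UNIV \<gamma>"
    unfolding \<gamma>_def \<sigma>_def by (intro continuous_intros continuous_on_tanh) simp_all
  have abfr: "a \<in> frontier P" "b \<in> frontier P" using ab by blast+
  then have cl: "a \<in> closure P" "b \<in> closure P" by (simp_all add: frontier_def)
  have X\<gamma>: "1 - X k ((1 - r) *\<^sub>R a + r *\<^sub>R b) = (1 - r) * (1 - X k a) + r * (1 - X k b)" if "k \<in> {1..n}" for k r
    unfolding XY_add_scale(1)[OF that] by (simp add: algebra_simps)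
  have lip: "\<bar>h k (\<gamma> x) - h k (\<gamma> y)\<bar> \<le> 2 * \<bar>x - y\<bar>" if k: "k \<in> {1..n}" for k x y
  proof -
    have "0 \<le> 1 - X k a" "0 \<le> 1 - X k b" using X_le_1[OF k] cl by simp_all
    moreover have "0 < (1 - s) * (1 - X k a) + s * (1 - X k b)"
      using X_less_1[OF k pq(1)] unfolding X\<gamma>[OF k, of s, symmetric] p[symmetric] by simp
    then have "1 - X k a \<noteq> 0 \<or> 1 - X k b \<noteq> 0" by auto
    ultimately have "0 < (1 - X k a) + (1 - X k b)" by linarith
    from ln_affine_chord_lipschitz[OF \<open>0 \<le> 1 - X k a\<close> \<open>0 \<le> 1 - X k b\<close> this, of x y]
    show ?thesis unfolding h_def \<gamma>_def X\<gamma>[OF k] \<sigma>_def .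
  qed
  \<comment> \<open>Since \<open>1 - X i\<close> vanishes at \<open>a\<close>, its values at
    \<open>p\<close> and \<open>q\<close> are \<open>s\<close> and \<open>t\<close> times its value
    at \<open>b\<close>, and this common factor drops out of the increment of \<open>h i\<close>.
    The same holds at the other end for \<open>j\<close>.\<close>
  obtain i where i: "i \<in> {1..n}" "X i a = 1" using frontier_X[OF abfr(1)] by blast
  obtain j where j: "j \<in> {1..n}" "X j b = 1" using frontier_X[OF abfr(2)] by blast
  have Tp: "1 - X k p = (1 - s) * (1 - X k a) + s * (1 - X k b)"
    and Tq: "1 - X k q = (1 - t) * (1 - X k a) + t * (1 - X k b)" if "k \<in> {1..n}" for k
    using X\<gamma>[OF that, of s] X\<gamma>[OF that, of t] unfolding p[symmetric] q[symmetric] by blast+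
  have hi: "h i q - h i p = ln t - ln s"
  proof -
    have T: "1 - X i p = s * (1 - X i b)" "1 - X i q = t * (1 - X i b)"
      using Tp[OF i(1)] Tq[OF i(1)] i(2) by simp_all
    have "0 < s * (1 - X i b)" unfolding T(1)[symmetric] using X_less_1[OF i(1) pq(1)] by simp
    then have "0 < 1 - X i b" using st(1) by (rule zero_less_mult_pos)
    then show ?thesis using st unfolding h_def T by (simp add: ln_mult)
  qed
  have hj: "h j p - h j q = ln (1 - s) - ln (1 - t)"
  proof -
    have T: "1 - X j p = (1 - s) * (1 - X j a)" "1 - X j q = (1 - t) * (1 - X j a)"
      using Tp[OF j(1)] Tq[OF j(1)] j(2) by simp_all
    have "0 < (1 - s) * (1 - X j a)" unfolding T(1)[symmetric] using X_less_1[OF j(1) pq(1)] by simp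
    moreover have "0 < 1 - s" using st by simp
    ultimately have "0 < 1 - X j a" by (rule zero_less_mult_pos)
    then show ?thesis using st unfolding h_def T by (simp add: ln_mult)
  qed
  have "2 * hilbert_dist P p q \<le> \<bar>h i p - h i q\<bar> + \<bar>h j p - h j q\<bar>"
  proof -
    have "2 * hilbert_dist P p q = (h i q - h i p) + (h j p - h j q)" unfolding hd hi hj by simp
    also have "\<dots> \<le> \<bar>h i p - h i q\<bar> + \<bar>h j p - h j q\<bar>"
      by (intro add_mono) (simp_all add: abs_if)
    finally show ?thesis .
  qed
  moreover have "\<forall>k\<in>{1..n}. \<forall>x y. \<bar>h k (\<gamma> x) - h k (\<gamma> y)\<bar> \<le> 2 * \<bar>x - y\<bar>"
    using lip by blast
  ultimately show thesis
    by (intro that[OF cont \<gamma>_in endpoints \<open>u < u'\<close> len _ i(1) j(1)])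
qed

section \<open>Comparison of logarithmic increments inside one sector\<close>

lemma one_minus_X_sector:
  assumes "k \<in> {1..n}" "j \<in> {1..n}"
  shows "1 - X j p = (1 - X k p) + (1 - X j (v k)) * (X k p - Y k p) / 2 + (1 - X j (v (k + 1))) * (X k p + Y k p) / 2"
  using X_sector_comb[OF assms, of p] by (simp add: field_simps)

lemma h_local_bound:
  assumes k: "k \<in> {1..n}" and j: "j \<in> {1..n}"
  shows "\<exists>C\<ge>0. \<forall>p\<in>P \<inter> sector k. \<forall>q\<in>P \<inter> sector k.
    \<bar>h j p - h j q\<bar> \<le> C * (\<bar>artanh (X k p) - artanh (X k q)\<bar> + \<bar>artanh (Y k p) - artanh (Y k q)\<bar>)"
proof -
  define a b where "a = 1 - X j (v k)" and "b = 1 - X j (v (k + 1))"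
  have ab: "0 \<le> a" "0 \<le> b" using X_v_le_1[OF j k] by (simp_all add: a_def b_def)
  define N where "N = nat \<lceil>1 + a + b\<rceil>"
  have N: "1 + a + b \<le> real N" using real_nat_ceiling_ge by (simp only: N_def)
  have "\<bar>h j p - h j q\<bar> \<le> real N * (2 * (\<bar>artanh (X k p) - artanh (X k q)\<bar> + \<bar>artanh (Y k p) - artanh (Y k q)\<bar>))"
    if pq: "p \<in> P \<inter> sector k" "q \<in> P \<inter> sector k" for p q
  proof -
    have B: "\<bar>X k z\<bar> < 1" "\<bar>Y k z\<bar> < 1" "\<bar>Y k z\<bar> \<le> X k z" "0 < 1 - X j z"
      and T: "1 - X j z = (1 - X k z) + a * (X k z - Y k z) / 2 + b * (X k z + Y k z) / 2"
      if "z \<in> P \<inter> sector k" for z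
      using that P_XY_bound[OF k, of z] X_less_1[OF j, of z] one_minus_X_sector[OF k j, of z]
      unfolding a_def b_def by auto
    \<comment> \<open>The form \<open>T\<close> has nonnegative terms only, but not all of them are
      controlled by \<open>artanh\<close>. This form has controlled terms, and its first coefficient
      may be negative. With absolute values its terms regroup into those of \<open>T\<close> with
      factors at most \<open>1 + a + b\<close>, whence \<open>N\<close>.\<close>
    have comb: "1 - X j z = (1 - (a + b) / 2) * (1 - X k z) + (a / 2) * (1 - Y k z) + (b / 2) * (1 + Y k z)"
      if "z \<in> P \<inter> sector k" for z
      unfolding T[OF that] by (simp add: field_simps)
    have bound: "\<bar>1 - (a + b) / 2\<bar> * (1 - X k z) + \<bar>a / 2\<bar> * (1 - Y k z) + \<bar>b / 2\<bar> * (1 + Y k z) \<le> real N * (1 - X j z)"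
      if z: "z \<in> P \<inter> sector k" for z
    proof -
      note Bz = B[OF z]
      have "\<bar>1 - (a + b) / 2\<bar> * (1 - X k z) \<le> (1 + (a + b) / 2) * (1 - X k z)"
      proof (rule mult_right_mono)
        show "\<bar>1 - (a + b) / 2\<bar> \<le> 1 + (a + b) / 2" using ab by (intro abs_leI) argo+
      qed (use Bz in simp)
      moreover have "\<bar>a / 2\<bar> = a / 2" "\<bar>b / 2\<bar> = b / 2" using ab by auto
      moreover have "(1 + (a + b) / 2) * (1 - X k z) + a / 2 * (1 - Y k z) + b / 2 * (1 + Y k z)
         = (1 + a + b) * (1 - X k z) + a * (X k z - Y k z) / 2 + b * (X k z + Y k z) / 2"
        by (simp add: field_simps)
      moreover have "a * (X k z - Y k z) / 2 \<le> (1 + a + b) * (a * (X k z - Y k z) / 2)"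
        "b * (X k z + Y k z) / 2 \<le> (1 + a + b) * (b * (X k z + Y k z) / 2)"
        using ab Bz by (intro mult_left_mono[of 1 "1 + a + b", simplified] mult_right_mono[of 1 "1 + a + b", simplified]; simp)+
      moreover have "(1 + a + b) * (1 - X k z) + (1 + a + b) * (a * (X k z - Y k z) / 2) + (1 + a + b) * (b * (X k z + Y k z) / 2)
          = (1 + a + b) * (1 - X j z)"
        unfolding T[OF z] by (simp only: distrib_left)
      moreover have "(1 + a + b) * (1 - X j z) \<le> real N * (1 - X j z)"
        using N Bz by (intro mult_right_mono) auto
      ultimately show ?thesis by linarith
    qed
    note Bp = B[OF pq(1)] and Bq = B[OF pq(2)]
    show ?thesis unfolding h_def
    proof (rule abs_ln_diff_le_of_combination3[OF Bq(4) Bp(4) _ _ _ _ _ _ comb[OF pq(2)] comb[OF pq(1)] bound[OF pq(2)] bound[OF pq(1)]])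
      show "\<bar>ln (1 - X k p) - ln (1 - X k q)\<bar> \<le> 2 * (\<bar>artanh (X k p) - artanh (X k q)\<bar> + \<bar>artanh (Y k p) - artanh (Y k q)\<bar>)"
        by (rule order_trans[OF ln_diff_le_artanh(1)[OF Bp(1) Bq(1)]]) simp
      show "\<bar>ln (1 - Y k p) - ln (1 - Y k q)\<bar> \<le> 2 * (\<bar>artanh (X k p) - artanh (X k q)\<bar> + \<bar>artanh (Y k p) - artanh (Y k q)\<bar>)"
        by (rule order_trans[OF ln_diff_le_artanh(1)[OF Bp(2) Bq(2)]]) simp
      show "\<bar>ln (1 + Y k p) - ln (1 + Y k q)\<bar> \<le> 2 * (\<bar>artanh (X k p) - artanh (X k q)\<bar> + \<bar>artanh (Y k p) - artanh (Y k q)\<bar>)"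
        by (rule order_trans[OF ln_diff_le_artanh(2)[OF Bp(2) Bq(2)]]) simp
    qed (use Bp Bq in auto)
  qed
  then show ?thesis by (intro exI[of _ "2 * real N"]) (simp add: mult.assoc mult.left_commute)
qed

text \<open>At the corner \<open>v (k + 1)\<close> the edge \<open>k\<close> meets the edge \<open>j\<close> (similarly at \<open>v k\<close>), and \<open>1 - \<tau> * Y k\<close> is a
  combination of the functions \<open>1 - X k\<close> and \<open>1 - X j\<close> that vanish on these edges.\<close>

lemma ln_corner_bound:
  assumes k: "k \<in> {1..n}" and j: "j \<in> {1..n}" and a: "0 < a" and \<tau>: "\<tau> = 1 \<or> \<tau> = (-1::real)"
    and T: "\<And>z. 1 - X j z = (1 - X k z) + a * (X k z - \<tau> * Y k z) / 2"
  shows "\<exists>C\<ge>0. \<forall>p\<in>P \<inter> sector k. \<forall>q\<in>P \<inter> sector k. \<forall>D.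
    \<bar>h j p - h j q\<bar> \<le> D \<longrightarrow> \<bar>h k p - h k q\<bar> \<le> D \<longrightarrow> \<bar>ln (1 - \<tau> * Y k p) - ln (1 - \<tau> * Y k q)\<bar> \<le> C * D"
proof -
  \<comment> \<open>With absolute values, the coefficients \<open>1 - 2 / a\<close> and
    \<open>2 / a\<close> of \<open>comb\<close> give at most
    \<open>(1 + 4 / a) * (1 - X k z) + (X k z - \<tau> * Y k z)\<close>. This is at most
    \<open>1 + 4 / a\<close> times \<open>1 - \<tau> * Y k z\<close>.\<close>
  define N where "N = nat \<lceil>1 + 4 / a\<rceil>"
  have N: "1 + 4 / a \<le> real N" using real_nat_ceiling_ge by (simp only: N_def)
  have "\<bar>ln (1 - \<tau> * Y k p) - ln (1 - \<tau> * Y k q)\<bar> \<le> real N * D"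
    if pq: "p \<in> P \<inter> sector k" "q \<in> P \<inter> sector k" and D: "\<bar>h j p - h j q\<bar> \<le> D" "\<bar>h k p - h k q\<bar> \<le> D" for p q D
  proof -
    have B: "0 < 1 - X k z" "0 < 1 - X j z" "0 < 1 - \<tau> * Y k z" "0 \<le> X k z - \<tau> * Y k z"
      if "z \<in> P \<inter> sector k" for z
      using that P_XY_bound[OF k, of z] X_less_1[OF j, of z] \<tau> by auto
    have comb: "1 - \<tau> * Y k z = (1 - 2 / a) * (1 - X k z) + (2 / a) * (1 - X j z) + 0 * 1" for z
    proof -
      have "(2 / a) * (1 - X j z) = (2 / a) * (1 - X k z) + (X k z - \<tau> * Y k z)"
        unfolding T using a by (simp add: field_simps)
      then show ?thesis by (simp add: algebra_simps)
    qed
    have bound: "\<bar>1 - 2 / a\<bar> * (1 - X k z) + \<bar>2 / a\<bar> * (1 - X j z) + \<bar>0\<bar> * 1 \<le> real N * (1 - \<tau> * Y k z)"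
      if z: "z \<in> P \<inter> sector k" for z
    proof -
      note Bz = B[OF z]
      have "0 < 2 / a" using a by simp
      then have "\<bar>1 - 2 / a\<bar> \<le> 1 + 2 / a" "\<bar>2 / a\<bar> = 2 / a" by (intro abs_leI, linarith+)
      then have "\<bar>1 - 2 / a\<bar> * (1 - X k z) + \<bar>2 / a\<bar> * (1 - X j z) + \<bar>0\<bar> * 1
        \<le> (1 + 2 / a) * (1 - X k z) + 2 / a * (1 - X j z)"
        using Bz by (simp add: mult_right_mono)
      also have "\<dots> = (1 + 4 / a) * (1 - X k z) + 1 * (X k z - \<tau> * Y k z)"
        unfolding T using a by (simp add: field_simps)
      also have "\<dots> \<le> (1 + 4 / a) * (1 - X k z) + (1 + 4 / a) * (X k z - \<tau> * Y k z)"
        using Bz a by (intro add_left_mono mult_right_mono) simp_all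
      also have "\<dots> = (1 + 4 / a) * (1 - \<tau> * Y k z)" by (simp add: algebra_simps)
      also have "\<dots> \<le> real N * (1 - \<tau> * Y k z)"
        using N Bz by (intro mult_right_mono) simp_all
      finally show ?thesis .
    qed
    note Bp = B[OF pq(1)] and Bq = B[OF pq(2)]
    show ?thesis
      by (rule abs_ln_diff_le_of_combination3[OF Bq(3) Bp(3) Bq(1) Bp(1) Bq(2) Bp(2) zero_less_one zero_less_one
            comb comb bound[OF pq(2)] bound[OF pq(1)]])
        (use D in \<open>simp_all add: h_def\<close>)
  qed
  then show ?thesis by (intro exI[of _ "real N"]) simp
qed

text \<open>For the nonnegative coordinate \<open>X k\<close> the function \<open>h k\<close> is
  enough. \<open>Y k\<close> may approach both 1 and -1, so both \<open>1 + Y k\<close> and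
  \<open>1 - Y k\<close> have to be controlled, each by the neighbouring edge at its corner.\<close>

lemma artanh_local_bound:
  assumes k: "k \<in> {1..n}"
  shows "\<exists>C\<ge>0. \<forall>p\<in>P \<inter> sector k. \<forall>q\<in>P \<inter> sector k. \<forall>D. (\<forall>j\<in>{1..n}. \<bar>h j p - h j q\<bar> \<le> D) \<longrightarrow>
    \<bar>artanh (X k p) - artanh (X k q)\<bar> + \<bar>artanh (Y k p) - artanh (Y k q)\<bar> \<le> C * D"
proof -
  obtain j where j: "j \<in> {1..n}" "X j (v k) = 1" "X j (v (k + 1)) < 1"
    using adjacent_edges(1)[OF k] by blast
  obtain i where i: "i \<in> {1..n}" "X i (v (k + 1)) = 1" "X i (v k) < 1"
    using adjacent_edges(2)[OF k] by blast
  \<comment> \<open>Edge \<open>j\<close> passes through \<open>v k\<close>, where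
    \<open>Y k\<close> is -1, so it controls \<open>1 + Y k\<close>. This is the case of \<tau>
    equal to -1; edge \<open>i\<close> at \<open>v (k + 1)\<close> is the case of 1.\<close>
  have Tj: "1 - X j z = (1 - X k z) + (1 - X j (v (k + 1))) * (X k z - (-1) * Y k z) / 2" for z
    using one_minus_X_sector[OF k j(1), of z] unfolding j(2) by simp
  have Ti: "1 - X i z = (1 - X k z) + (1 - X i (v k)) * (X k z - 1 * Y k z) / 2" for z
    using one_minus_X_sector[OF k i(1), of z] unfolding i(2) by simp
  have pos: "0 < 1 - X j (v (k + 1))" "0 < 1 - X i (v k)" using i(3) j(3) by simp_all
  obtain C1 where C1: "0 \<le> C1" "\<forall>p\<in>P \<inter> sector k. \<forall>q\<in>P \<inter> sector k. \<forall>D.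
      \<bar>h j p - h j q\<bar> \<le> D \<longrightarrow> \<bar>h k p - h k q\<bar> \<le> D \<longrightarrow> \<bar>ln (1 - (-1) * Y k p) - ln (1 - (-1) * Y k q)\<bar> \<le> C1 * D"
    using ln_corner_bound[OF k j(1) pos(1) disjI2[OF refl] Tj] by (elim exE conjE)
  obtain C2 where C2: "0 \<le> C2" "\<forall>p\<in>P \<inter> sector k. \<forall>q\<in>P \<inter> sector k. \<forall>D.
      \<bar>h i p - h i q\<bar> \<le> D \<longrightarrow> \<bar>h k p - h k q\<bar> \<le> D \<longrightarrow> \<bar>ln (1 - 1 * Y k p) - ln (1 - 1 * Y k q)\<bar> \<le> C2 * D"
    using ln_corner_bound[OF k i(1) pos(2) disjI1[OF refl] Ti] by (elim exE conjE)
  have "\<bar>artanh (X k p) - artanh (X k q)\<bar> + \<bar>artanh (Y k p) - artanh (Y k q)\<bar> \<le> (1 + C1 + C2) * D"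
    if pq: "p \<in> P \<inter> sector k" "q \<in> P \<inter> sector k" and D: "\<forall>j\<in>{1..n}. \<bar>h j p - h j q\<bar> \<le> D" for p q D
  proof -
    have B: "\<bar>Y k z\<bar> < 1" "0 \<le> X k z" "X k z < 1" if "z \<in> P \<inter> sector k" for z
      using that P_XY_bound[OF k, of z] by auto
    note Bp = B[OF pq(1)] and Bq = B[OF pq(2)]
    have Dj: "\<bar>h j p - h j q\<bar> \<le> D" and Di: "\<bar>h i p - h i q\<bar> \<le> D" and Dk: "\<bar>h k p - h k q\<bar> \<le> D"
      using D j(1) i(1) k by blast+
    have x: "\<bar>artanh (X k p) - artanh (X k q)\<bar> \<le> D"
      using artanh_diff_le_ln[OF Bp(2,3) Bq(2,3)] Dk unfolding h_def by linarith
    have "\<bar>ln (1 - (-1) * Y k p) - ln (1 - (-1) * Y k q)\<bar> \<le> C1 * D"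
      using C1(2)[rule_format, OF pq Dj Dk] .
    then have y1: "\<bar>ln (1 + Y k p) - ln (1 + Y k q)\<bar> \<le> C1 * D" by simp
    have "\<bar>ln (1 - 1 * Y k p) - ln (1 - 1 * Y k q)\<bar> \<le> C2 * D"
      using C2(2)[rule_format, OF pq Di Dk] .
    then have y2: "\<bar>ln (1 - Y k p) - ln (1 - Y k q)\<bar> \<le> C2 * D" by simp
    have "2 * \<bar>artanh (Y k p) - artanh (Y k q)\<bar> \<le> C1 * D + C2 * D"
      using ln_diff_le_artanh(3)[OF Bp(1) Bq(1)] y1 y2 by linarith
    moreover have "0 \<le> C1 * D + C2 * D" using y1 y2 by linarith
    ultimately show ?thesis using x by (simp add: distrib_right)
  qed
  then show ?thesis using C1(1) C2(1) by (intro exI[of _ "1 + C1 + C2"]) simp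
qed

text \<open>Seen from the target of \<open>f\<close>, the quantities \<open>artanh (X k)\<close> and
  \<open>artanh (Y k)\<close> are the linear coordinates \<open>X k\<close> and \<open>Y k\<close>,
  so the bound inside a sector becomes a Lipschitz bound for the norm.\<close>

lemma h_unmap_lipschitz:
  assumes j: "j \<in> {1..n}"
  shows "\<exists>C\<ge>0. C-lipschitz_on UNIV (\<lambda>q. h j (polygon_unmap q))"
proof -
  have "\<exists>C\<ge>0. C-lipschitz_on (sector k) (\<lambda>q. h j (polygon_unmap q))" if k: "k \<in> {1..n}" for k
  proof -
    obtain C where C: "0 \<le> C" "\<forall>p\<in>P \<inter> sector k. \<forall>q\<in>P \<inter> sector k.
      \<bar>h j p - h j q\<bar> \<le> C * (\<bar>artanh (X k p) - artanh (X k q)\<bar> + \<bar>artanh (Y k p) - artanh (Y k q)\<bar>)"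
      using h_local_bound[OF k j] by (elim exE conjE)
    obtain K1 where K1: "0 < K1" "\<And>z. norm (X k z) \<le> K1 * norm z"
      using linear_bounded_pos[OF X_linear[OF k]] by metis
    obtain K2 where K2: "0 < K2" "\<And>z. norm (Y k z) \<le> K2 * norm z"
      using linear_bounded_pos[OF Y_linear[OF k]] by metis
    have "(C * (K1 + K2))-lipschitz_on (sector k) (\<lambda>q. h j (polygon_unmap q))"
    proof (rule lipschitz_onI)
      fix a b assume ab: "a \<in> sector k" "b \<in> sector k"
      have un: "polygon_unmap z \<in> P \<inter> sector k" "artanh (X k (polygon_unmap z)) = X k z"
        "artanh (Y k (polygon_unmap z)) = Y k z" if "z \<in> sector k" for z
        unfolding polygon_unmap_eq[OF k that] XY_chart[OF k] artanh_tanh_real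
        using chart_tanh_in[OF k that] by simp_all
      have "\<bar>h j (polygon_unmap a) - h j (polygon_unmap b)\<bar> \<le> C * (\<bar>X k a - X k b\<bar> + \<bar>Y k a - Y k b\<bar>)"
        using C(2)[rule_format, OF un(1)[OF ab(1)] un(1)[OF ab(2)]] unfolding un(2,3)[OF ab(1)] un(2,3)[OF ab(2)] .
      also have "\<dots> \<le> C * (K1 * norm (a - b) + K2 * norm (a - b))"
      proof (intro mult_left_mono add_mono C(1))
        show "\<bar>X k a - X k b\<bar> \<le> K1 * norm (a - b)"
          using K1(2)[of "a - b"] linear_diff[OF X_linear[OF k], of a b] by simp
        show "\<bar>Y k a - Y k b\<bar> \<le> K2 * norm (a - b)"
          using K2(2)[of "a - b"] linear_diff[OF Y_linear[OF k], of a b] by simp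
      qed
      finally show "dist (h j (polygon_unmap a)) (h j (polygon_unmap b)) \<le> C * (K1 + K2) * dist a b"
        by (simp add: dist_norm algebra_simps)
    qed (use C(1) K1(1) K2(1) in simp)
    then show ?thesis using C(1) K1(1) K2(1) by (intro exI[of _ "C * (K1 + K2)"]) simp
  qed
  then obtain C where "0 \<le> C" "\<forall>k\<in>{1..n}. C-lipschitz_on (sector k) (\<lambda>q. h j (polygon_unmap q))"
    using finite_uniform_constant[of "{1..n}" "\<lambda>k C. C-lipschitz_on (sector k) (\<lambda>q. h j (polygon_unmap q))"]
      lipschitz_on_le by blast
  moreover have "(\<Union>k\<in>{1..n}. sector k) = UNIV" using sectors_cover by blast
  ultimately have "C-lipschitz_on UNIV (\<lambda>q. h j (polygon_unmap q))"
    by (intro lipschitz_on_closed_cover[of "{1..n}" sector] closed_sector) simp_all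
  then show ?thesis using \<open>0 \<le> C\<close> by blast
qed

lemma hilbert_le_dist:
  "\<exists>C\<ge>0. \<forall>p\<in>P. \<forall>q\<in>P. hilbert_dist P p q \<le> C * dist (polygon_map n v p) (polygon_map n v q)"
proof -
  obtain C where C: "0 \<le> C" "\<forall>j\<in>{1..n}. C-lipschitz_on UNIV (\<lambda>q. h j (polygon_unmap q))"
    using finite_uniform_constant[of "{1..n}" "\<lambda>j C. C-lipschitz_on UNIV (\<lambda>q. h j (polygon_unmap q))"]
      h_unmap_lipschitz lipschitz_on_le by blast
  have "hilbert_dist P p q \<le> C * dist (polygon_map n v p) (polygon_map n v q)" if pq: "p \<in> P" "q \<in> P" for p q
  proof (cases "p = q")
    case True
    then show ?thesis by (simp add: hilbert_dist_def)
  next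
    case False
    obtain i j where ij: "i \<in> {1..n}" "j \<in> {1..n}" "2 * hilbert_dist P p q \<le> \<bar>h i p - h i q\<bar> + \<bar>h j p - h j q\<bar>"
      by (rule hilbert_chord[OF pq False])
    have "\<bar>h k p - h k q\<bar> \<le> C * dist (polygon_map n v p) (polygon_map n v q)" if k: "k \<in> {1..n}" for k
      using lipschitz_onD[OF bspec[OF C(2) k] UNIV_I UNIV_I, of "polygon_map n v p" "polygon_map n v q"]
      unfolding polygon_unmap_map[OF pq(1)] polygon_unmap_map[OF pq(2)] by (simp add: dist_norm)
    from this[OF ij(1)] this[OF ij(2)] ij(3) show ?thesis by linarith
  qed
  then show ?thesis using C(1) by blast
qed

lemma dist_le_hilbert:
  "\<exists>C\<ge>0. \<forall>p\<in>P. \<forall>q\<in>P. dist (polygon_map n v p) (polygon_map n v q) \<le> C * hilbert_dist P p q"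
proof -
  let ?f = "polygon_map n v"
  \<comment> \<open>\<open>D\<close> is a common bound for all increments of \<open>h\<close>; it
    will be supplied by the Hilbert length between two parameters of a chord.\<close>
  define Q where "Q k C \<longleftrightarrow> (\<forall>p\<in>P \<inter> sector k. \<forall>q\<in>P \<inter> sector k. \<forall>D\<ge>0.
    (\<forall>j\<in>{1..n}. \<bar>h j p - h j q\<bar> \<le> D) \<longrightarrow> dist (?f p) (?f q) \<le> C * D)" for k C
  have "\<exists>C\<ge>0. \<forall>k\<in>{1..n}. Q k C"
  proof (rule finite_uniform_constant)
    show "Q k C'" if "Q k C" "C \<le> C'" for k C C'
      using that unfolding Q_def by (meson mult_right_mono order_trans)
    fix k assume k: "k \<in> {1..n}"
    obtain C where C: "0 \<le> C" "\<forall>p\<in>P \<inter> sector k. \<forall>q\<in>P \<inter> sector k. \<forall>D. (\<forall>j\<in>{1..n}. \<bar>h j p - h j q\<bar> \<le> D) \<longrightarrow>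
      \<bar>artanh (X k p) - artanh (X k q)\<bar> + \<bar>artanh (Y k p) - artanh (Y k q)\<bar> \<le> C * D"
      using artanh_local_bound[OF k] by (elim exE conjE)
    define K where "K = norm (v k) + norm (v (k + 1))"
    have K: "0 \<le> K" by (simp add: K_def)
    have comb: "norm (((x - y) / 2) *\<^sub>R a + ((x + y) / 2) *\<^sub>R b) \<le> (\<bar>x\<bar> + \<bar>y\<bar>) * (norm a + norm b)"
      for x y and a b :: "real \<times> real"
    proof -
      have "norm (((x - y) / 2) *\<^sub>R a + ((x + y) / 2) *\<^sub>R b) \<le> \<bar>(x - y) / 2\<bar> * norm a + \<bar>(x + y) / 2\<bar> * norm b"
        using norm_triangle_ineq[of "((x - y) / 2) *\<^sub>R a" "((x + y) / 2) *\<^sub>R b"] by simp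
      also have "\<dots> \<le> (\<bar>x\<bar> + \<bar>y\<bar>) * norm a + (\<bar>x\<bar> + \<bar>y\<bar>) * norm b"
        by (intro add_mono mult_right_mono) auto
      finally show ?thesis by (simp add: distrib_left)
    qed
    have "dist (?f p) (?f q) \<le> C * K * D"
      if pq: "p \<in> P \<inter> sector k" "q \<in> P \<inter> sector k" and D: "\<forall>j\<in>{1..n}. \<bar>h j p - h j q\<bar> \<le> D" for p q D
    proof -
      have f: "?f p = chart artanh k p" "?f q = chart artanh k q"
        using pq polygon_map_eq[OF k] by blast+
      let ?x = "artanh (X k p) - artanh (X k q)" and ?y = "artanh (Y k p) - artanh (Y k q)"
      have diff: "((x - y) / 2) *\<^sub>R a + ((x + y) / 2) *\<^sub>R b - (((x' - y') / 2) *\<^sub>R a + ((x' + y') / 2) *\<^sub>R b)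
          = (((x - x') - (y - y')) / 2) *\<^sub>R a + (((x - x') + (y - y')) / 2) *\<^sub>R b"
        for x y x' y' and a b :: "real \<times> real"
        by (simp add: prod_eq_iff field_simps)
      have "dist (?f p) (?f q) \<le> (\<bar>?x\<bar> + \<bar>?y\<bar>) * K"
        unfolding f dist_norm chart_def diff K_def by (rule comb)
      also have "\<dots> \<le> C * D * K"
        using C(2)[rule_format, OF pq, of D] D K by (intro mult_right_mono) simp_all
      finally show ?thesis by (simp add: mult.assoc mult.left_commute mult.commute)
    qed
    then have "Q k (C * K)" unfolding Q_def by blast
    then show "\<exists>C\<ge>0. Q k C" using C(1) K by (intro exI[of _ "C * K"]) simp
  qed simp
  then obtain C where C: "0 \<le> C" "\<forall>k\<in>{1..n}. Q k C" by blast
  have "dist (?f p) (?f q) \<le> 2 * C * hilbert_dist P p q" if pq: "p \<in> P" "q \<in> P" for p q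
  proof (cases "p = q")
    case True
    then show ?thesis by (simp add: hilbert_dist_def)
  next
    case False
    obtain \<gamma> u u' where \<gamma>: "continuous_on UNIV \<gamma>" "\<forall>x. \<gamma> x \<in> P" "\<gamma> u = p" "\<gamma> u' = q"
      "u < u'" "u' - u = hilbert_dist P p q"
      "\<forall>k\<in>{1..n}. \<forall>x y. \<bar>h k (\<gamma> x) - h k (\<gamma> y)\<bar> \<le> 2 * \<bar>x - y\<bar>"
      by (rule hilbert_chord[OF pq False])
    \<comment> \<open>Between the parameters \<open>x\<close> and \<open>y\<close> every
      \<open>h k\<close> changes by at most \<open>2 * \<bar>x - y\<bar>\<close>, which explains the
      factor 2. The preimages of the sectors under \<open>\<gamma>\<close> cover the parameter line,
      where the gluing takes place.\<close>
    have "(2 * C)-lipschitz_on UNIV (\<lambda>x. ?f (\<gamma> x))"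
    proof (rule lipschitz_on_closed_cover[of "{1..n}" "\<lambda>k. \<gamma> -` sector k"])
      show "closed (\<gamma> -` sector k)" if "k \<in> {1..n}" for k
        by (rule closed_vimage[OF closed_sector[OF that] \<gamma>(1)])
      show "(\<Union>k\<in>{1..n}. \<gamma> -` sector k) = UNIV" using sectors_cover by blast
      show "(2 * C)-lipschitz_on (\<gamma> -` sector k) (\<lambda>x. ?f (\<gamma> x))" if k: "k \<in> {1..n}" for k
      proof (rule lipschitz_onI)
        fix x y assume "x \<in> \<gamma> -` sector k" "y \<in> \<gamma> -` sector k"
        then have xy: "\<gamma> x \<in> P \<inter> sector k" "\<gamma> y \<in> P \<inter> sector k" using \<gamma>(2) by simp_all
        have "dist (?f (\<gamma> x)) (?f (\<gamma> y)) \<le> C * (2 * \<bar>x - y\<bar>)"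
          using bspec[OF C(2) k, unfolded Q_def, rule_format, OF xy, of "2 * \<bar>x - y\<bar>"] \<gamma>(7) by simp
        then show "dist (?f (\<gamma> x)) (?f (\<gamma> y)) \<le> 2 * C * dist x y" by (simp add: dist_real_def)
      qed (use C(1) in simp)
    qed (use C(1) in simp_all)
    from lipschitz_onD[OF this UNIV_I UNIV_I, of u u'] show ?thesis
      using \<gamma>(3-6) by (simp add: dist_real_def)
  qed
  then show ?thesis using C(1) by (intro exI[of _ "2 * C"]) simp
qed

lemma polygon_map_bilipschitz:
  "\<exists>C\<ge>1. \<forall>p\<in>P. \<forall>q\<in>P.
     1 / C * hilbert_dist P p q \<le> l1_dist (polygon_map n v p) (polygon_map n v q) \<and>
     l1_dist (polygon_map n v p) (polygon_map n v q) \<le> C * hilbert_dist P p q"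
proof -
  let ?f = "polygon_map n v"
  obtain C1 where C1: "0 \<le> C1" "\<forall>p\<in>P. \<forall>q\<in>P. hilbert_dist P p q \<le> C1 * dist (?f p) (?f q)"
    using hilbert_le_dist by (elim exE conjE)
  obtain C2 where C2: "0 \<le> C2" "\<forall>p\<in>P. \<forall>q\<in>P. dist (?f p) (?f q) \<le> C2 * hilbert_dist P p q"
    using dist_le_hilbert by (elim exE conjE)
  \<comment> \<open>The summand 1 ensures \<open>C \<ge> 1\<close>, and the factor 2 pays for
    passing from the Euclidean norm to the l1-norm.\<close>
  define C where "C = 1 + C1 + 2 * C2"
  have C: "1 \<le> C" "C1 \<le> C" "2 * C2 \<le> C" using C1(1) C2(1) by (simp_all add: C_def)
  have "1 / C * hilbert_dist P p q \<le> l1_dist (?f p) (?f q) \<and> l1_dist (?f p) (?f q) \<le> C * hilbert_dist P p q"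
    if pq: "p \<in> P" "q \<in> P" for p q
  proof -
    have l1: "dist (?f p) (?f q) \<le> l1_dist (?f p) (?f q)" "l1_dist (?f p) (?f q) \<le> 2 * dist (?f p) (?f q)"
      unfolding l1_dist_def dist_norm by (rule l1_norm_bounds)+
    have 1: "hilbert_dist P p q \<le> C1 * dist (?f p) (?f q)" using C1(2) pq by blast
    have 2: "dist (?f p) (?f q) \<le> C2 * hilbert_dist P p q" using C2(2) pq by blast
    have "C1 * dist (?f p) (?f q) \<le> C * l1_dist (?f p) (?f q)"
      using C(1,2) l1(1) by (intro mult_mono) simp_all
    then have lower: "hilbert_dist P p q \<le> C * l1_dist (?f p) (?f q)" using 1 by linarith
    have nonneg: "0 \<le> hilbert_dist P p q"
    proof (cases "p = q")
      case False
      obtain u u' where "u < u'" "u' - u = hilbert_dist P p q" by (rule hilbert_chord[OF pq False])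
      then show ?thesis by linarith
    qed (simp add: hilbert_dist_def)
    have "2 * C2 * hilbert_dist P p q \<le> C * hilbert_dist P p q"
      using C(3) nonneg by (rule mult_right_mono)
    then have "l1_dist (?f p) (?f q) \<le> C * hilbert_dist P p q" using 2 l1(2) by linarith
    moreover have "1 / C * hilbert_dist P p q \<le> l1_dist (?f p) (?f q)"
      using lower C(1) by (simp add: divide_le_eq mult.commute)
    ultimately show ?thesis by blast
  qed
  then show ?thesis using C(1) by blast
qed

end

theorem theorem3p1:
  fixes P :: "(real \<times> real) set" and n :: nat and v :: "nat \<Rightarrow> real \<times> real"
  assumes "open_convex_polygon P n v" and "0 \<in> P"
  shows "(\<exists>g. homeomorphism P UNIV (polygon_map n v) g) \<and>
    (let U = P - (\<Union>k\<in>{1..n}. {s *\<^sub>R v k | s. 0 \<le> s \<and> s < 1});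
         V = UNIV - (\<Union>k\<in>{1..n}. {s *\<^sub>R v k | s. 0 \<le> s})
     in open U \<and> open V \<and> polygon_map n v ` U = V \<and>
        smooth_diffeomorphism U V (polygon_map n v)) \<and>
    (\<exists>C\<ge>1. \<forall>p\<in>P. \<forall>q\<in>P.
        1 / C * hilbert_dist P p q \<le> l1_dist (polygon_map n v p) (polygon_map n v q) \<and>
        l1_dist (polygon_map n v p) (polygon_map n v q) \<le> C * hilbert_dist P p q)"
proof -
  interpret polygon_around_origin P n v
    using assms by unfold_locales
  note diffeo = polygon_smooth_diffeomorphism
  have "open (\<Union>k\<in>{1..n}. open_sector k \<inter> P)" "open (\<Union>k\<in>{1..n}. open_sector k)"
    using diffeo(2) by (simp_all only: smooth_diffeomorphism_def)
  then show ?thesis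
    unfolding Let_def polygon_complement_vertex_segments complement_vertex_rays
    using polygon_homeomorphism diffeo polygon_map_bilipschitz by blast
qed

end
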